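(* Let $n \ge 0$ be an integer and let $c_0, c_1, \ldots, c_{2^n}$ be complex numbers with $\sum_{k=0}^{2^n} c_k = 2$. Then the refinement equation $$\varphi(x) = \sum_{k=0}^{2^n} c_k\, \varphi(2x \ominus k), \qquad x \in \mathbb{R}_+,$$ has a solution $\varphi \in H_d'$, nonzero and unique up to multiplication by a constant in $H_d'$. The support of $\varphi$ lies in the segment $[0, 2^n]$, and (with appropriate normalization of the constant) the Walsh--Fourier transform of $\varphi$ is given by $$\widehat\varphi(y) = \prod_{j=1}^{\infty} m\bigl(2^{-j} y\bigr), \qquad m(y) = \frac12 \sum_{k=0}^{2^n} c_k\, \mathbf{w}_k(y).$$ Moreover, let $\varphi$ be normalized by this formula and let $T$ be the operator $Tf(x) = \sum_{k=0}^{2^n} c_k f(2x \ominus k)$. Then for each compactly supported summable function $f \in L_2(\mathbb{R}_+)$, the sequence $T^k f$ converges in $H_d'$, as $k \to \infty$, to the solution $c\,\varphi$ of the refinement equation, where $c = \int_{\mathbb{R}_+} f(x)\, dx$.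
   Context: $\mathbb{R}_+ = [0,\infty)$. Each $x \in \mathbb{R}_+$ is written in binary form $x = \sum_{k \in \mathbb{Z}} x_k 2^k$, $x_k \in \{0,1\}$, with $x_k = 0$ for all sufficiently large $k$ (for dyadic rationals the finite expansion is used). Dyadic addition is $x \oplus y = \sum_{k} 2^k (x_k + y_k)_2$, where $(x_k+y_k)_2$ is the sum modulo $2$, and $x \ominus y = x \oplus y$. The measure is Lebesgue measure. For $x, y \in \mathbb{R}_+$ put $(y,x) = \sum_{k \in \mathbb{Z}} y_k x_{-1-k}$ (finitely many nonzero terms). For an integer $k \ge 0$ the Walsh function is $\mathbf{w}_k(x) = (-1)^{(k,x)}$, and $\psi(x,y) = \mathbf{w}_{[y]}(x)\, \mathbf{w}_{[x]}(y)$, where $[\cdot]$ is the integer part. The Walsh--Fourier transform of $f \in L_1(\mathbb{R}_+)$ is $\widehat f(y) = \int_{\mathbb{R}_+} \psi(x,y) f(x)\, dx$, extended to $L_2(\mathbb{R}_+)$ in the usual way; it is an invertible orthogonal transform of $L_2(\mathbb{R}_+)$, and $\check{h}$ denotes the inverse Walsh--Fourier transform of $h$. $H_d$ is the space of test functions consisting of all finite (complex) linear combinations of indicator functions $\chi_{\Delta_{j,k}}$ of dyadic intervals $\Delta_{j,k} = [2^{-j}k, 2^{-j}(k+1))$, $j \in \mathbb{Z}$, $k \in \mathbb{Z}_{\ge 0}$ ($j$ is called the rank of the interval). Its topology is defined by convergence to zero: $f_k \to 0$ if the ranks of the intervals in all $f_k$ are bounded above, all $f_k$ are supported in one fixed segment,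 and $f_k \to 0$ pointwise. $H_d$ is invariant under the Walsh--Fourier transform. $H_d'$ is the space of distributions, i.e. of continuous linear functionals $h \mapsto (f,h)$ on $H_d$; a sequence converges in $H_d'$ if it converges on each test function $h \in H_d$. A locally summable function $f$ is identified with the distribution $(f,h) = \int_{\mathbb{R}_+} f h\, dx$. The Walsh--Fourier transform of $f \in H_d'$ is defined by $(\widehat f, h) = (f, \check h)$, $h \in H_d$. For $f \in H_d'$ the distribution $f(2x \ominus k)$ is defined by duality via the change of variables: $(f(2\,\cdot \ominus k), h) = \frac12 \bigl(f, h\bigl((\cdot \oplus k)/2\bigr)\bigr)$. A distribution $f$ has support in $[0,2^n]$ if $(f,h)=0$ for every $h \in H_d$ vanishing on $[0,2^n]$.
   Formalization: Uniqueness up to a constant is stated among compactly supported distributions, not all of H_d', where it is false: for n=0, c_0=c_1=1, the sum of χ_[k,k+1) over k=2^(j+1) minus the sum over k=3·2^j (j≥0) is another solution. *)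

theory Defs
  imports "HOL-Analysis.Analysis"
begin

text \<open>
  Functions on the half-line are represented by total functions \<open>real \<Rightarrow> 'a\<close>; only their values on
  \<open>{0..}\<close> matter. Test functions vanish on the negative reals, so that equality of test functions
  is equality on the half-line.
\<close>

text \<open>
  The floor formula yields the terminating expansion of dyadic rationals.
\<close>

definition binary_digit :: "real \<Rightarrow> int \<Rightarrow> nat"
  where "binary_digit x k = nat \<lfloor>x / 2 powi k\<rfloor> mod 2"

definition dyadic_add :: "real \<Rightarrow> real \<Rightarrow> real"  (infixl \<open>\<oplus>\<close> 65)
  where "x \<oplus> y =
    (\<Sum>\<^sub>\<infinity>k::int. 2 powi k * real ((binary_digit x k + binary_digit y k) mod 2))"

abbreviation dyadic_diff :: "real \<Rightarrow> real \<Rightarrow> real"  (infixl \<open>\<ominus>\<close> 65)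
  where "x \<ominus> y \<equiv> x \<oplus> y"

definition dyadic_pairing :: "real \<Rightarrow> real \<Rightarrow> nat"
  where "dyadic_pairing y x =
    (\<Sum>k | binary_digit y k * binary_digit x (- 1 - k) \<noteq> 0. binary_digit y k * binary_digit x (- 1 - k))"

definition walsh :: "nat \<Rightarrow> real \<Rightarrow> complex"
  where "walsh k x = (- 1) ^ dyadic_pairing (real k) x"

definition walsh_kernel :: "real \<Rightarrow> real \<Rightarrow> complex"
  where "walsh_kernel x y = walsh (nat \<lfloor>y\<rfloor>) x * walsh (nat \<lfloor>x\<rfloor>) y"

definition walsh_fourier :: "(real \<Rightarrow> complex) \<Rightarrow> real \<Rightarrow> complex"
  where "walsh_fourier f y =
    (if 0 \<le> y then (LINT x:{0..}|lebesgue. walsh_kernel x y * f x) else 0)"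


subsection \<open>Test functions and distributions\<close>

definition dyadic_interval :: "int \<Rightarrow> nat \<Rightarrow> real set"
  where "dyadic_interval j k = {2 powi (- j) * real k ..< 2 powi (- j) * (real k + 1)}"

definition test_funs_rank_le :: "int \<Rightarrow> (real \<Rightarrow> complex) set"
  where "test_funs_rank_le J = {h. \<exists>S a. finite S \<and> (\<forall>(j, k)\<in>S. j \<le> J) \<and>
    h = (\<lambda>x. \<Sum>(j, k)\<in>S. a j k * indicator (dyadic_interval j k) x)}"

definition test_funs :: "(real \<Rightarrow> complex) set"
  where "test_funs = (\<Union>J. test_funs_rank_le J)"

definition test_conv_zero :: "(nat \<Rightarrow> real \<Rightarrow> complex) \<Rightarrow> bool"
  where "test_conv_zero f \<longleftrightarrow>
    (\<exists>J. \<forall>i. f i \<in> test_funs_rank_le J) \<and>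
    (\<exists>b. \<forall>i. \<forall>x. x \<notin> {0..b} \<longrightarrow> f i x = 0) \<and>
    (\<forall>x. (\<lambda>i. f i x) \<longlonglongrightarrow> 0)"

type_synonym functional = "(real \<Rightarrow> complex) \<Rightarrow> complex"

text \<open>
  Distributions are extensional on the test functions, so that equality of distributions is \<open>(=)\<close>.
\<close>

definition distributions :: "functional set"
  where "distributions = {F \<in> extensional test_funs.
    (\<forall>g\<in>test_funs. \<forall>h\<in>test_funs. F (\<lambda>x. g x + h x) = F g + F h) \<and>
    (\<forall>a. \<forall>h\<in>test_funs. F (\<lambda>x. a * h x) = a * F h) \<and>
    (\<forall>f. test_conv_zero f \<longrightarrow> (\<lambda>i. F (f i)) \<longlonglongrightarrow> 0)}"

definition scale_dist :: "complex \<Rightarrow> functional \<Rightarrow> functional"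
  where "scale_dist a F = (\<lambda>h\<in>test_funs. a * F h)"

definition dist_converges :: "(nat \<Rightarrow> functional) \<Rightarrow> functional \<Rightarrow> bool"
  where "dist_converges F G \<longleftrightarrow> (\<forall>h\<in>test_funs. (\<lambda>i. F i h) \<longlonglongrightarrow> G h)"

definition locally_summable :: "(real \<Rightarrow> complex) \<Rightarrow> bool"
  where "locally_summable f \<longleftrightarrow> (\<forall>b. set_integrable lebesgue {0..b} f)"

text \<open>
  Meaningful for locally summable functions only.
\<close>

definition dist_of_fun :: "(real \<Rightarrow> complex) \<Rightarrow> functional"
  where "dist_of_fun f = (\<lambda>h\<in>test_funs. LINT x:{0..}|lebesgue. f x * h x)"

definition inverse_walsh_fourier :: "(real \<Rightarrow> complex) \<Rightarrow> real \<Rightarrow> complex"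
  where "inverse_walsh_fourier = inv_into test_funs walsh_fourier"

definition walsh_fourier_dist :: "functional \<Rightarrow> functional"
  where "walsh_fourier_dist F = (\<lambda>h\<in>test_funs. F (inverse_walsh_fourier h))"

text \<open>
  The distribution \<open>F(2x \<ominus> k)\<close>. The case distinction keeps the transformed test function zero on the
  negative reals.
\<close>

definition dilate_dist :: "nat \<Rightarrow> functional \<Rightarrow> functional"
  where "dilate_dist k F =
    (\<lambda>h\<in>test_funs. 1 / 2 * F (\<lambda>x. if 0 \<le> x then h ((x \<oplus> real k) / 2) else 0))"

definition supported_in :: "functional \<Rightarrow> real set \<Rightarrow> bool"
  where "supported_in F A \<longleftrightarrow> (\<forall>h\<in>test_funs. (\<forall>x\<in>A. h x = 0) \<longrightarrow> F h = 0)"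

text \<open>
  Solutions of refinement equations are unique up to constants only among distributions of compact
  support. For instance \<open>\<phi>(x) = \<phi>(2x) + \<phi>(2x \<ominus> 1)\<close> is solved by the indicator of \<open>[0,1)\<close>, but also by
  the function with value \<open>1\<close> on \<open>[2^(j+1), 2^(j+1) + 1)\<close>, value \<open>-1\<close> on \<open>[3 * 2^j, 3 * 2^j + 1)\<close> for
  all \<open>j \<ge> 0\<close>, and \<open>0\<close> elsewhere.
\<close>

definition compactly_supported :: "functional \<Rightarrow> bool"
  where "compactly_supported F \<longleftrightarrow> (\<exists>N::nat. supported_in F {0..2 ^ N})"


subsection \<open>Refinement equations\<close>

definition refinement_solution :: "nat \<Rightarrow> (nat \<Rightarrow> complex) \<Rightarrow> functional \<Rightarrow> bool"
  where "refinement_solution n c F \<longleftrightarrow> F \<in> distributions \<and>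
    F = (\<lambda>h\<in>test_funs. \<Sum>k=0..2 ^ n. c k * dilate_dist k F h)"

definition refinement_mask :: "nat \<Rightarrow> (nat \<Rightarrow> complex) \<Rightarrow> real \<Rightarrow> complex"
  where "refinement_mask n c y = 1 / 2 * (\<Sum>k=0..2 ^ n. c k * walsh k y)"

definition refinement_operator ::
    "nat \<Rightarrow> (nat \<Rightarrow> complex) \<Rightarrow> (real \<Rightarrow> complex) \<Rightarrow> real \<Rightarrow> complex"
  where "refinement_operator n c f = (\<lambda>x. \<Sum>k=0..2 ^ n. c k * f (2 * x \<ominus> real k))"

text \<open>
  The support is the essential one, as elements of the Lebesgue spaces are classes of functions.
\<close>

definition compactly_supported_L1_L2 :: "(real \<Rightarrow> complex) \<Rightarrow> bool"
  where "compactly_supported_L1_L2 f \<longleftrightarrow>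
    set_integrable lebesgue {0..} f \<and>
    set_integrable lebesgue {0..} (\<lambda>x. (cmod (f x))\<^sup>2) \<and>
    (\<exists>b\<ge>0. AE x in lebesgue. b < x \<longrightarrow> f x = 0)"

end

theory Submission
  imports Defs
begin

text \<open>
  Let \<open>D h(x) = 1/2 \<Sum>\<^sub>k c\<^sub>k h((x \<oplus> k) / 2)\<close> be the transpose of \<open>T\<close> on test functions. A distribution \<open>F\<close>
  solves the refinement equation iff \<open>F (D h) = F h\<close> for all \<open>h\<close>, so everything depends on the iterates of \<open>D\<close>.
  Two observations settle their behaviour.

  First, \<open>D\<close> coarsens: if \<open>h\<close> is constant on the dyadic intervals of length \<open>2^(-r)\<close>, then \<open>D h\<close> is constant
  on those of length \<open>2^(-r+1)\<close> (\<open>rank_le_adjoint\<close>). Hence for each \<open>M\<close> the function \<open>D^L h\<close> is constant on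
  \<open>[0, 2^M)\<close> for all large \<open>L\<close>. Second, if \<open>M \<ge> n\<close>, a constant value on \<open>[0, 2^M)\<close> is preserved by \<open>D\<close>, because
  the coefficients sum to \<open>2\<close> and the maps \<open>x \<mapsto> (x \<oplus> k) / 2\<close> preserve this interval (\<open>adjoint_const_on\<close>).
  So \<open>D^L h\<close> is eventually equal to one number \<open>\<phi>(h)\<close> on any given bounded interval
  (\<open>adjoint_funpow_eq_cascade_limit\<close>).

  This number depends linearly on \<open>h\<close>, and linear functionals on test functions are automatically
  continuous (\<open>linear_functional_is_distribution\<close>); thus \<open>\<phi>\<close> is a distribution. By construction
  \<open>\<phi>(D h) = \<phi>(h)\<close>, the support is in \<open>[0, 2^n]\<close>, and \<open>\<phi>\<close> is \<open>1\<close> on the indicator of \<open>[0, 2^n)\<close>. If \<open>F\<close> is another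
  solution with compact support, then \<open>F h = F (D^L h)\<close>, and where \<open>F\<close> looks, \<open>D^L h\<close> is the constant \<open>\<phi>(h)\<close>;
  this is uniqueness (\<open>solution_unique\<close>). In the same way \<open>\<integral> (T^L f) h = \<integral> f (D^L h)\<close> is eventually
  \<open>\<phi>(h) \<integral> f\<close> (\<open>cascade_converges\<close>).

  For the transform, \<open>D\<close> maps the character \<open>\<psi>(\<cdot>, y)\<close> to \<open>m(y / 2) \<psi>(\<cdot>, y / 2)\<close> (\<open>adjoint_wave\<close>), so \<open>\<phi>\<close> takes
  the value \<open>\<Prod>\<^sub>j m(2^(-j) y)\<close> on this character, suitably cut off; the product is finite because \<open>m = 1\<close>
  near the origin. Writing a test function as a finite combination of characters by Walsh--Fourier
  inversion yields \<open>\<phi>(h) = \<integral> (\<Prod>\<^sub>j m(2^(-j) y)) h^(y) dy\<close> (\<open>cascade_limit_eq_integral\<close>).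
\<close>


section \<open>Binary digits\<close>

lemma floor_divide_two_powi_add:
  "\<lfloor>x / 2 powi (j + int m)\<rfloor> = \<lfloor>x / 2 powi j\<rfloor> div 2 ^ m" for x :: real
proof -
  have "x / 2 powi (j + int m) = (x / 2 powi j) / real_of_int (2 ^ m)"
    by (simp add: power_int_add)
  then show ?thesis
    by (simp only: floor_divide_real_eq_div zero_le_power zero_le_numeral)
qed

lemma binary_digit_bit:
  assumes "0 \<le> x"
  shows "binary_digit x (j + int m) = of_bool (bit (nat \<lfloor>x / 2 powi j\<rfloor>) m)"
proof -
  have "nat (\<lfloor>x / 2 powi j\<rfloor> div 2 ^ m) = nat \<lfloor>x / 2 powi j\<rfloor> div 2 ^ m"
    using assms by (simp add: nat_div_distrib nat_power_eq)
  then show ?thesis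
    by (simp add: binary_digit_def floor_divide_two_powi_add bit_iff_odd mod2_eq_if)
qed

lemma binary_digit_le_1: "binary_digit x i \<le> 1"
  by (simp add: binary_digit_def mod2_eq_if)

lemma binary_digit_cases: "binary_digit x i = 0 \<or> binary_digit x i = 1"
  using binary_digit_le_1[of x i] by linarith

lemma binary_digit_0 [simp]: "binary_digit 0 i = 0"
  by (simp add: binary_digit_def)

text \<open>
  The digits at positions \<open>\<ge> j\<close> are the bits of \<open>\<lfloor>x / 2^j\<rfloor>\<close>. Comparison of digits is thus comparison
  of dyadic intervals, and with \<open>0\<close> as second point it decides \<open>x < 2^j\<close>.
\<close>

lemma digits_agree_iff_floor:
  assumes "0 \<le> x" "0 \<le> y"
  shows "(\<forall>i\<ge>j. binary_digit x i = binary_digit y i) \<longleftrightarrow> \<lfloor>x / 2 powi j\<rfloor> = \<lfloor>y / 2 powi j\<rfloor>"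
proof -
  have "(\<forall>i\<ge>j. binary_digit x i = binary_digit y i)
      \<longleftrightarrow> (\<forall>m. binary_digit x (j + int m) = binary_digit y (j + int m))"
    by (metis zle_iff_zadd)
  also have "\<dots> \<longleftrightarrow> nat \<lfloor>x / 2 powi j\<rfloor> = nat \<lfloor>y / 2 powi j\<rfloor>"
    by (simp only: binary_digit_bit assms of_bool_eq_iff) (simp add: bit_eq_iff)
  also have "\<dots> \<longleftrightarrow> \<lfloor>x / 2 powi j\<rfloor> = \<lfloor>y / 2 powi j\<rfloor>"
    using assms by (simp add: eq_nat_nat_iff)
  finally show ?thesis .
qed

lemma less_two_powi_iff_digits:
  assumes "0 \<le> x"
  shows "x < 2 powi j \<longleftrightarrow> (\<forall>i\<ge>j. binary_digit x i = 0)"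
  using digits_agree_iff_floor[OF assms order_refl, of j] assms
  by (simp add: floor_eq_iff)

lemma less_two_power_iff_digits:
  assumes "0 \<le> x"
  shows "x < 2 ^ N \<longleftrightarrow> (\<forall>i\<ge>int N. binary_digit x i = 0)"
  using less_two_powi_iff_digits[OF assms, of "int N"] by simp

lemma binary_digit_divide_power: "binary_digit (x / 2 ^ m) i = binary_digit x (i + int m)"
  by (simp add: binary_digit_def power_int_add mult.commute)

lemma binary_digit_half: "binary_digit (x / 2) i = binary_digit x (i + 1)"
  using binary_digit_divide_power[of x 1 i] by simp

lemma binary_digit_of_nat: "binary_digit (real l) (int m) = of_bool (bit l m)"
  using binary_digit_bit[of "real l" 0 m] by simp

lemma binary_digit_of_nat_neg:
  assumes "i < 0" shows "binary_digit (real l) i = 0"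
proof -
  obtain m where m: "i = - int (Suc m)"
    using assms by (metis int_cases less_le_not_le of_nat_0_le_iff)
  have "real l / 2 powi i = real (2 * (l * 2 ^ m))"
    unfolding m power_int_minus power_int_of_nat by (simp add: divide_simps)
  then show ?thesis
    unfolding binary_digit_def by (metis floor_of_nat mod_mult_self1_is_0 nat_int)
qed

lemma binary_digit_node:
  "binary_digit (real l / 2 ^ K) i = (if - int K \<le> i then of_bool (bit l (nat (i + int K))) else 0)"
proof (cases "- int K \<le> i")
  case True
  then show ?thesis
    using binary_digit_of_nat[of l "nat (i + int K)"] by (simp add: binary_digit_divide_power)
qed (simp add: binary_digit_divide_power binary_digit_of_nat_neg)

text \<open>
  The weighted digits telescope: \<open>2^i x_i = 2^i \<lfloor>x / 2^i\<rfloor> - 2^(i+1) \<lfloor>x / 2^(i+1)\<rfloor>\<close>. Summing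
  downwards from a position above all digits, the partial sums are the truncations of \<open>x\<close>.
\<close>

lemma binary_expansion:
  assumes "0 \<le> x"
  shows "((\<lambda>i. 2 powi i * real (binary_digit x i)) has_sum x) UNIV"
proof -
  define t where "t i = 2 powi i * real_of_int \<lfloor>x / 2 powi i\<rfloor>" for i :: int
  have tele: "2 powi i * real (binary_digit x i) = t i - t (i + 1)" for i
  proof -
    let ?q = "\<lfloor>x / 2 powi i\<rfloor>"
    have q: "\<lfloor>x / 2 powi (i + 1)\<rfloor> = ?q div 2"
      using floor_divide_two_powi_add[of x i 1] by simp
    have "nat (?q mod 2) = binary_digit x i"
      using assms by (simp add: binary_digit_def nat_mod_distrib)
    then have "real (binary_digit x i) = real_of_int (?q mod 2)"
      by (metis of_nat_nat pos_mod_sign zero_less_numeral)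
    then have d: "real (binary_digit x i) = real_of_int ?q - 2 * real_of_int (?q div 2)"
      by (simp add: minus_mult_div_eq_mod[symmetric])
    show ?thesis
      unfolding t_def q d by (simp add: power_int_add algebra_simps)
  qed
  obtain A where A: "x < 2 ^ A"
    using real_arch_pow[of 2 x] by auto
  have tA: "t (int A) = 0"
    using A assms by (simp add: t_def floor_eq_iff)
  have partial: "(\<Sum>m<M. 2 powi (int A - 1 - int m) * real (binary_digit x (int A - 1 - int m)))
      = t (int A - int M)" for M
  proof (induction M)
    case (Suc M)
    have "int A - int (Suc M) = int A - 1 - int M" "int A - 1 - int M + 1 = int A - int M"
      by simp_all
    then show ?case
      using Suc by (simp only: sum.lessThan_Suc tele)
  qed (simp add: tA)
  have "(\<lambda>M. t (int A - int M)) \<longlonglongrightarrow> x"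
  proof (rule real_tendsto_sandwich)
    show "\<forall>\<^sub>F M in sequentially. x - 2 ^ A / 2 ^ M \<le> t (int A - int M)"
    proof (intro always_eventually allI)
      fix M
      have "x / 2 powi (int A - int M) - 1 \<le> \<lfloor>x / 2 powi (int A - int M)\<rfloor>" by linarith
      then have "2 powi (int A - int M) * (x / 2 powi (int A - int M) - 1) \<le> t (int A - int M)"
        unfolding t_def by (rule mult_left_mono) simp
      then show "x - 2 ^ A / 2 ^ M \<le> t (int A - int M)"
        by (simp add: algebra_simps power_int_diff)
    qed
    show "\<forall>\<^sub>F M in sequentially. t (int A - int M) \<le> x"
    proof (intro always_eventually allI)
      fix M
      have "\<lfloor>x / 2 powi (int A - int M)\<rfloor> \<le> x / 2 powi (int A - int M)" by linarith
      then have "t (int A - int M) \<le> 2 powi (int A - int M) * (x / 2 powi (int A - int M))"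
        unfolding t_def by (rule mult_left_mono) simp
      then show "t (int A - int M) \<le> x" by simp
    qed
    show "(\<lambda>M. x - 2 ^ A / 2 ^ M) \<longlonglongrightarrow> x"
      using tendsto_diff[OF tendsto_const[of x] LIMSEQ_divide_realpow_zero[of 2 "2 ^ A"]] by simp
  qed simp
  then have "(\<lambda>m. 2 powi (int A - 1 - int m) * real (binary_digit x (int A - 1 - int m))) sums x"
    by (simp add: sums_def partial)
  then have *: "((\<lambda>m. 2 powi (int A - 1 - int m) * real (binary_digit x (int A - 1 - int m)))
      has_sum x) UNIV"
    by (rule sums_nonneg_imp_has_sum) simp
  have bij: "bij_betw (\<lambda>m. int A - 1 - int m) UNIV {..<int A}"
    by (rule bij_betw_byWitness[where f' = "\<lambda>i. nat (int A - 1 - i)"]) auto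
  have "((\<lambda>i. 2 powi i * real (binary_digit x i)) has_sum x) {..<int A}"
    using * has_sum_reindex_bij_betw[OF bij, of "\<lambda>i. 2 powi i * real (binary_digit x i)"] by blast
  then show ?thesis
    by (rule has_sum_cong_neutral[THEN iffD1, rotated -1])
      (use A less_two_power_iff_digits[OF assms, of A] in auto)
qed

text \<open>
  A digitwise sum modulo \<open>2\<close> need not be the digit sequence of a number, as it may end in ones only.
  Dyadic sums are therefore computed by exhibiting a number that has these digits.
\<close>

lemma dyadic_add_eqI:
  assumes "0 \<le> z" "\<And>i. binary_digit z i = (binary_digit x i + binary_digit y i) mod 2"
  shows "x \<oplus> y = z"
  using binary_expansion[OF assms(1)] by (simp add: dyadic_add_def infsumI flip: assms(2))


section \<open>Dyadic translation by a natural number\<close>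

text \<open>
  At positions below the binary point the number is scaled by a positive power of two, so that an integer summand becomes
  even and does not affect the digit.
\<close>

lemma binary_digit_add_int_neg:
  assumes "i < 0" "0 \<le> r" shows "binary_digit (real l + r) i = binary_digit r i"
proof -
  obtain m where m: "i = - int (Suc m)"
    using assms by (metis int_cases less_le_not_le of_nat_0_le_iff)
  have *: "(real l + r) / 2 powi i = r / 2 powi i + of_int (2 * (int l * 2 ^ m))"
    unfolding m power_int_minus power_int_of_nat by (simp add: divide_simps algebra_simps)
  have "nat (\<lfloor>r / 2 powi i\<rfloor> + 2 * (int l * 2 ^ m)) = nat \<lfloor>r / 2 powi i\<rfloor> + 2 * (l * 2 ^ m)"
    using assms(2) by (simp add: nat_add_distrib nat_mult_distrib nat_power_eq)
  then show ?thesis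
    unfolding binary_digit_def * floor_add_int[symmetric] by simp
qed

lemma binary_digit_xor:
  assumes "0 \<le> r" "r < 1"
  shows "binary_digit (real (xor l k) + r) i =
    (binary_digit (real l + r) i + binary_digit (real k) i) mod 2"
proof (cases "i < 0")
  case True
  then show ?thesis
    using assms binary_digit_le_1[of r i]
    by (simp add: binary_digit_add_int_neg binary_digit_of_nat_neg)
next
  case False
  have "\<lfloor>r\<rfloor> = 0"
    using assms by (simp add: floor_eq_iff)
  obtain m where i: "i = 0 + int m"
    using False by (metis add_0 linorder_not_le zero_le_imp_eq_int)
  have "binary_digit (real l + r) (0 + int m) = of_bool (bit l m)" for l
    using assms \<open>\<lfloor>r\<rfloor> = 0\<close> by (subst binary_digit_bit) simp_all
  then show ?thesis
    using binary_digit_of_nat[of k m] unfolding i by (simp add: bit_xor_iff)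
qed

text \<open>
  The fractional part is left alone and the integer part is permuted; this reduces integrals that
  involve \<open>x \<oplus> k\<close> to ordinary translations of unit intervals.
\<close>

lemma dyadic_add_nat:
  assumes "0 \<le> r" "r < 1"
  shows "(real l + r) \<oplus> real k = real (xor l k) + r"
  using assms by (intro dyadic_add_eqI binary_digit_xor) simp_all

lemma
  assumes "0 \<le> x"
  shows dyadic_add_nat_nonneg: "0 \<le> x \<oplus> real k"
    and binary_digit_dyadic_add_nat:
      "binary_digit (x \<oplus> real k) i = (binary_digit x i + binary_digit (real k) i) mod 2"
proof -
  have x: "x = real (nat \<lfloor>x\<rfloor>) + frac x"
    using assms by (simp add: frac_def)
  have *: "x \<oplus> real k = real (xor (nat \<lfloor>x\<rfloor>) k) + frac x"
    by (subst x, rule dyadic_add_nat) (simp_all add: frac_lt_1)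
  show "0 \<le> x \<oplus> real k"
    unfolding * by simp
  show "binary_digit (x \<oplus> real k) i = (binary_digit x i + binary_digit (real k) i) mod 2"
    unfolding * by (subst binary_digit_xor) (simp_all add: frac_lt_1 flip: x)
qed

lemma dyadic_add_nat_involution:
  assumes "0 \<le> x"
  shows "(x \<oplus> real k) \<oplus> real k = x"
proof (rule dyadic_add_eqI[OF assms])
  fix i
  show "binary_digit x i = (binary_digit (x \<oplus> real k) i + binary_digit (real k) i) mod 2"
    using binary_digit_cases[of x i] binary_digit_cases[of "real k" i]
    by (elim disjE) (simp_all add: binary_digit_dyadic_add_nat[OF assms])
qed

lemma dyadic_add_nat_less_iff:
  assumes "0 \<le> x" "real k < 2 ^ N"
  shows "x \<oplus> real k < 2 ^ N \<longleftrightarrow> x < 2 ^ N"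
proof -
  have "binary_digit (x \<oplus> real k) i = binary_digit x i" if "int N \<le> i" for i
  proof -
    have "binary_digit (real k) i = 0"
      using assms(2) that less_two_power_iff_digits[of "real k" N] by simp
    then show ?thesis
      using binary_digit_cases[of x i] by (auto simp: binary_digit_dyadic_add_nat[OF assms(1)])
  qed
  then show ?thesis
    by (simp add: less_two_power_iff_digits assms(1) dyadic_add_nat_nonneg)
qed


section \<open>The Walsh kernel as a character\<close>

lemma ex_power_bound: "\<exists>N. \<forall>x\<in>X. x < 2 ^ N" if "finite X" for X :: "real set"
proof -
  obtain N where "Max (insert 0 X) < 2 ^ N"
    using real_arch_pow[of 2 "Max (insert 0 X)"] by auto
  then show ?thesis
    using that by (meson Max_ge finite_insert insertCI le_less_trans)
qed

lemma dyadic_pairing_eq_sum: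
  assumes "0 \<le> x" "x < 2 ^ A" "0 \<le> y" "y < 2 ^ A"
  shows "dyadic_pairing y x =
    (\<Sum>i\<in>{- int A..<int A}. binary_digit y i * binary_digit x (- 1 - i))"
  unfolding dyadic_pairing_def
proof (rule sum.mono_neutral_left)
  have "i < int A" if "binary_digit y i \<noteq> 0" for i
    using that assms(3,4) less_two_power_iff_digits[of y A] by (meson not_le)
  moreover have "- int A \<le> i" if "binary_digit x (- 1 - i) \<noteq> 0" for i
  proof -
    have "- 1 - i < int A"
      using that assms(1,2) less_two_power_iff_digits[of x A] by (meson not_le)
    then show ?thesis by simp
  qed
  ultimately show "{i. binary_digit y i * binary_digit x (- 1 - i) \<noteq> 0} \<subseteq> {- int A..<int A}"
    by auto
qed auto

lemma dyadic_pairing_commute: "dyadic_pairing y x = dyadic_pairing x y"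
  unfolding dyadic_pairing_def
  by (rule sum.reindex_bij_witness[of _ "\<lambda>i. - 1 - i" "\<lambda>i. - 1 - i"]) (auto simp: mult.commute)

lemma dyadic_pairing_half: "dyadic_pairing y (x / 2) = dyadic_pairing (y / 2) x"
proof -
  have *: "- 1 - (i - 1) = - i" "- 1 - i + 1 = - i" "- i - 1 = - 1 - i" for i :: int
    by simp_all
  show ?thesis
    unfolding dyadic_pairing_def binary_digit_half
    by (intro sum.reindex_bij_witness[of _ "\<lambda>i. i + 1" "\<lambda>i. i - 1"]) (auto simp: *)
qed

lemma dyadic_pairing_cong:
  assumes "\<And>i. binary_digit y i * binary_digit x (- 1 - i) =
    binary_digit y' i * binary_digit x' (- 1 - i)"
  shows "dyadic_pairing y x = dyadic_pairing y' x'"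
  unfolding dyadic_pairing_def assms ..

lemma minus_one_power_mod_2_cong:
  "a mod 2 = b mod 2 \<Longrightarrow> (- 1) ^ a = (- 1 :: 'a :: ring_1) ^ b" for a b :: nat
  by (metis even_iff_mod_2_eq_zero neg_one_even_power neg_one_odd_power)

lemma dyadic_pairing_add_parity:
  assumes nonneg: "0 \<le> y" "0 \<le> x" "0 \<le> x'" "0 \<le> z"
    and z: "\<And>i. binary_digit z i = (binary_digit x i + binary_digit x' i) mod 2"
  shows "(- 1 :: complex) ^ dyadic_pairing y z =
    (- 1) ^ dyadic_pairing y x * (- 1) ^ dyadic_pairing y x'"
proof -
  obtain A where A: "\<forall>u\<in>{x, x', y, z}. u < 2 ^ A"
    using ex_power_bound[of "{x, x', y, z}"] by auto
  let ?I = "{- int A..<int A}"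
  have parity: "(binary_digit y i * binary_digit z j) mod 2 =
      (binary_digit y i * binary_digit x j + binary_digit y i * binary_digit x' j) mod 2" for i j
    using binary_digit_cases[of y i] by (auto simp: z)
  have "dyadic_pairing y z mod 2 =
      (\<Sum>i\<in>?I. binary_digit y i * binary_digit z (- 1 - i) mod 2) mod 2"
    using A by (simp only: dyadic_pairing_eq_sum[where A = A] nonneg insertI1 insertI2 mod_sum_eq)
  also have "\<dots> = (\<Sum>i\<in>?I. binary_digit y i * binary_digit x (- 1 - i) +
      binary_digit y i * binary_digit x' (- 1 - i)) mod 2"
    by (simp only: parity mod_sum_eq)
  also have "\<dots> = (dyadic_pairing y x + dyadic_pairing y x') mod 2"
    using A by (simp only: dyadic_pairing_eq_sum[where A = A] nonneg insertI1 insertI2 sum.distrib)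
  finally show ?thesis
    unfolding power_add[symmetric] by (rule minus_one_power_mod_2_cong)
qed

lemma binary_digit_floor:
  assumes "0 \<le> x"
  shows "binary_digit (real (nat \<lfloor>x\<rfloor>)) i = (if 0 \<le> i then binary_digit x i else 0)"
proof (cases "0 \<le> i")
  case True
  then show ?thesis
    using binary_digit_bit[OF assms, of 0 "nat i"] binary_digit_of_nat[of "nat \<lfloor>x\<rfloor>" "nat i"] by simp
qed (simp add: binary_digit_of_nat_neg)

text \<open>
  The two factors of the kernel collect the nonnegative and the negative positions of the digits of
  \<open>y\<close>, so together they are the single sign \<open>(-1)^(\<Sum>k. y_k x_(-1-k))\<close>, which is visibly symmetric
  and multiplicative.
\<close>

lemma walsh_kernel_eq:
  assumes "0 \<le> x" "0 \<le> y"
  shows "walsh_kernel x y = (- 1) ^ dyadic_pairing y x"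
proof -
  obtain A where A: "\<forall>u\<in>{x, y, real (nat \<lfloor>x\<rfloor>), real (nat \<lfloor>y\<rfloor>)}. u < 2 ^ A"
    using ex_power_bound[of "{x, y, real (nat \<lfloor>x\<rfloor>), real (nat \<lfloor>y\<rfloor>)}"] by auto
  let ?I = "{- int A..<int A}"
  have "dyadic_pairing (real (nat \<lfloor>y\<rfloor>)) x + dyadic_pairing y (real (nat \<lfloor>x\<rfloor>)) =
      (\<Sum>i\<in>?I. binary_digit (real (nat \<lfloor>y\<rfloor>)) i * binary_digit x (- 1 - i)) +
      (\<Sum>i\<in>?I. binary_digit y i * binary_digit (real (nat \<lfloor>x\<rfloor>)) (- 1 - i))"
    by (rule arg_cong2[where f = "(+)"]; rule dyadic_pairing_eq_sum) (use A assms in auto)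
  also have "\<dots> = (\<Sum>i\<in>?I. binary_digit y i * binary_digit x (- 1 - i))"
    unfolding sum.distrib[symmetric]
    by (rule sum.cong)
      (simp_all only: binary_digit_floor[OF assms(1)] binary_digit_floor[OF assms(2)], auto)
  also have "\<dots> = dyadic_pairing y x"
    by (rule dyadic_pairing_eq_sum[symmetric]) (use A assms in auto)
  finally show ?thesis
    unfolding walsh_kernel_def walsh_def
    by (simp add: dyadic_pairing_commute[of _ y] flip: power_add)
qed

lemma walsh_kernel_commute:
  "0 \<le> x \<Longrightarrow> 0 \<le> y \<Longrightarrow> walsh_kernel x y = walsh_kernel y x"
  by (simp add: walsh_kernel_eq dyadic_pairing_commute)

lemma walsh_kernel_half:
  "0 \<le> x \<Longrightarrow> 0 \<le> y \<Longrightarrow> walsh_kernel (x / 2) y = walsh_kernel x (y / 2)"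
  by (simp add: walsh_kernel_eq dyadic_pairing_half)

lemma walsh_eq_kernel: "0 \<le> y \<Longrightarrow> walsh k y = walsh_kernel (real k) y"
  by (simp add: walsh_kernel_eq walsh_def dyadic_pairing_commute)

lemma walsh_kernel_dyadic_add:
  assumes "0 \<le> x" "0 \<le> y"
  shows "walsh_kernel (x \<oplus> real k) y = walsh_kernel x y * walsh k y"
  using dyadic_pairing_add_parity[of y x "real k" "x \<oplus> real k"] assms
  by (simp add: walsh_eq_kernel walsh_kernel_eq dyadic_add_nat_nonneg binary_digit_dyadic_add_nat)

lemma walsh_kernel_cong:
  assumes "0 \<le> x" "0 \<le> x'" "0 \<le> y" "y < 2 ^ A"
    and "\<And>i. - int A \<le> i \<Longrightarrow> binary_digit x i = binary_digit x' i"
  shows "walsh_kernel x y = walsh_kernel x' y"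
proof -
  have "dyadic_pairing y x = dyadic_pairing y x'"
  proof (rule dyadic_pairing_cong)
    fix i
    show "binary_digit y i * binary_digit x (- 1 - i) = binary_digit y i * binary_digit x' (- 1 - i)"
    proof (cases "i < int A")
      case False
      then show ?thesis
        using assms less_two_power_iff_digits[of y A] by simp
    qed (simp add: assms(5))
  qed
  then show ?thesis
    by (simp add: walsh_kernel_eq assms)
qed

lemma walsh_kernel_0: "0 \<le> y \<Longrightarrow> walsh_kernel 0 y = 1"
  by (simp add: walsh_kernel_eq dyadic_pairing_def)

lemma walsh_kernel_xor:
  assumes "0 \<le> u"
  shows "walsh_kernel u (real (xor l (2 ^ b)) / 2 ^ K) =
    walsh_kernel u (real l / 2 ^ K) * (- 1) ^ binary_digit u (int K - 1 - int b)"
proof -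
  define e where "e = real (2 ^ b) / 2 ^ K"
  have e: "binary_digit e i = of_bool (i = int b - int K)" for i
    unfolding e_def binary_digit_node by (auto simp: bit_exp_iff)
  have shift: "- 1 - (int b - int K) = int K - 1 - int b" by simp
  have *: "binary_digit e i * binary_digit u (- 1 - i) =
      (if i = int b - int K then binary_digit u (int K - 1 - int b) else 0)" for i
    by (simp only: e shift of_bool_def split: if_split) (simp add: shift)
  have "dyadic_pairing e u = binary_digit u (int K - 1 - int b)"
    unfolding dyadic_pairing_def * by (cases "binary_digit u (int K - 1 - int b) = 0") simp_all
  moreover have "binary_digit (real (xor l (2 ^ b)) / 2 ^ K) i =
      (binary_digit (real l / 2 ^ K) i + binary_digit e i) mod 2" for i
    unfolding e binary_digit_node by (auto simp: bit_xor_iff bit_exp_iff)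
  then have "(- 1 :: complex) ^ dyadic_pairing u (real (xor l (2 ^ b)) / 2 ^ K) =
      (- 1) ^ dyadic_pairing u (real l / 2 ^ K) * (- 1) ^ dyadic_pairing u e"
    by (intro dyadic_pairing_add_parity) (use assms in \<open>simp_all add: e_def\<close>)
  ultimately show ?thesis
    using assms by (simp add: walsh_kernel_eq dyadic_pairing_commute)
qed


section \<open>Step functions on a dyadic grid\<close>

text \<open>
  This says that \<open>h\<close> is constant on the dyadic intervals of rank \<open>r\<close>. Digits are preferred to
  intervals because \<open>x \<mapsto> x \<oplus> k\<close> and \<open>x \<mapsto> x / 2\<close> act on them position by position, with no distinction
  between positive and negative ranks.
\<close>

definition rank_le :: "int \<Rightarrow> (real \<Rightarrow> complex) \<Rightarrow> bool"
  where "rank_le r h \<longleftrightarrow>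
    (\<forall>x\<ge>0. \<forall>y\<ge>0. (\<forall>i\<ge>- r. binary_digit x i = binary_digit y i) \<longrightarrow> h x = h y)"

text \<open>
  Functions on the grid of the \<open>4^K\<close> intervals of length \<open>2^(-K)\<close> in \<open>[0, 2^K)\<close>. The Walsh--Fourier
  transform exchanges scale and support; tying both to one parameter makes each of these
  spaces invariant.
\<close>

definition dyadic_step :: "nat \<Rightarrow> (real \<Rightarrow> complex) \<Rightarrow> bool"
  where "dyadic_step K h \<longleftrightarrow> rank_le (int K) h \<and> (\<forall>x. x < 0 \<or> 2 ^ K \<le> x \<longrightarrow> h x = 0)"

lemma rank_leD:
  "rank_le r h \<Longrightarrow> 0 \<le> x \<Longrightarrow> 0 \<le> y \<Longrightarrow> (\<And>i. - r \<le> i \<Longrightarrow> binary_digit x i = binary_digit y i)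
    \<Longrightarrow> h x = h y"
  unfolding rank_le_def by blast

lemma rank_le_mono:
  assumes "rank_le r h" "r \<le> s"
  shows "rank_le s h"
  unfolding rank_le_def
proof (intro allI impI)
  fix x y :: real
  assume xy: "0 \<le> x" "0 \<le> y" and "\<forall>i\<ge>- s. binary_digit x i = binary_digit y i"
  then have "binary_digit x i = binary_digit y i" if "- r \<le> i" for i
    using that assms(2) by simp
  then show "h x = h y"
    using rank_leD[OF assms(1) xy] by blast
qed

lemma dyadic_step_mono: "dyadic_step K h \<Longrightarrow> K \<le> K' \<Longrightarrow> dyadic_step K' h"
  unfolding dyadic_step_def
  using power_increasing[of K K' "2 :: real"] rank_le_mono[of "int K" h "int K'"]
  by (meson of_nat_mono one_le_numeral order_trans)

lemma dyadic_step_outside: "dyadic_step K h \<Longrightarrow> x < 0 \<or> 2 ^ K \<le> x \<Longrightarrow> h x = 0"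
  by (auto simp: dyadic_step_def)

lemma mem_dyadic_interval:
  "x \<in> dyadic_interval j l \<longleftrightarrow> 0 \<le> x \<and> nat \<lfloor>x / 2 powi (- j)\<rfloor> = l"
proof -
  let ?w = "2 powi (- j) :: real"
  have w: "?w > 0" by simp
  have "x \<in> dyadic_interval j l \<longleftrightarrow> \<lfloor>x / ?w\<rfloor> = int l"
    using w by (simp add: dyadic_interval_def floor_eq_iff pos_le_divide_eq pos_divide_less_eq mult.commute)
  moreover have "\<lfloor>x / ?w\<rfloor> = int l \<longleftrightarrow> 0 \<le> x \<and> nat \<lfloor>x / ?w\<rfloor> = l"
  proof (cases "0 \<le> x")
    case True
    then have "0 \<le> \<lfloor>x / ?w\<rfloor>" by simp
    with True show ?thesis by auto
  next
    case False
    then have "\<lfloor>x / ?w\<rfloor> < 0" by (simp add: divide_neg_pos)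
    then have "\<lfloor>x / ?w\<rfloor> \<noteq> int l" using of_nat_0_le_iff[of l] by linarith
    with False show ?thesis by blast
  qed
  ultimately show ?thesis by simp
qed

lemma divide_two_powi_neg: "x / 2 powi (- int K) = x * 2 ^ K" for x :: real
  by (simp add: power_int_minus divide_inverse)

lemma mem_dyadic_interval_nat:
  "x \<in> dyadic_interval (int K) l \<longleftrightarrow> 0 \<le> x \<and> nat \<lfloor>x * 2 ^ K\<rfloor> = l"
  by (simp add: mem_dyadic_interval divide_two_powi_neg)

lemma rank_le_indicator: "rank_le j (indicator (dyadic_interval j l))"
  unfolding rank_le_def by (simp add: digits_agree_iff_floor indicator_def mem_dyadic_interval)

lemma rank_le_eq_node:
  assumes "rank_le (int K) h" "0 \<le> x"
  shows "h x = h (real (nat \<lfloor>x * 2 ^ K\<rfloor>) / 2 ^ K)"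
proof -
  have "\<forall>i\<ge>- int K. binary_digit x i = binary_digit (real (nat \<lfloor>x * 2 ^ K\<rfloor>) / 2 ^ K) i"
    using assms(2) by (subst digits_agree_iff_floor) (simp_all add: divide_two_powi_neg)
  then show ?thesis
    using assms by (auto intro: rank_leD)
qed

lemma cell_index_less:
  assumes "0 \<le> x" "x < 2 ^ K"
  shows "nat \<lfloor>x * 2 ^ K\<rfloor> < 4 ^ K"
proof -
  have "x * 2 ^ K < 2 ^ K * 2 ^ K"
    using assms by simp
  then have "x * 2 ^ K < 4 ^ K"
    by (simp flip: power_mult_distrib)
  then show ?thesis
    using assms by (simp add: nat_less_iff floor_less_iff)
qed

lemma node_less: "l < 4 ^ K \<Longrightarrow> real l / 2 ^ K < 2 ^ K"
proof -
  assume "l < 4 ^ K"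
  then have "real l < real (4 ^ K)" by (simp only: of_nat_less_iff)
  also have "real (4 ^ K) = 2 ^ K * 2 ^ K" by (simp flip: power_mult_distrib)
  finally show ?thesis by (simp add: divide_simps)
qed

lemma dyadic_step_expansion:
  assumes "dyadic_step K h"
  shows "h x = (\<Sum>l<4 ^ K. h (real l / 2 ^ K) * indicator (dyadic_interval (int K) l) x)"
proof (cases "0 \<le> x \<and> x < 2 ^ K")
  case True
  let ?l = "nat \<lfloor>x * 2 ^ K\<rfloor>"
  have "(\<Sum>l<4 ^ K. h (real l / 2 ^ K) * indicator (dyadic_interval (int K) l) x) =
      (\<Sum>l<4 ^ K. if l = ?l then h (real l / 2 ^ K) else 0)"
    using True by (intro sum.cong) (auto simp: indicator_def mem_dyadic_interval_nat)
  also have "\<dots> = h (real ?l / 2 ^ K)"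
    using True cell_index_less[of x K] by simp
  finally show ?thesis
    using assms True rank_le_eq_node[of K h x] by (simp add: dyadic_step_def)
next
  case False
  have "x \<notin> dyadic_interval (int K) l" if "l < 4 ^ K" for l
  proof
    assume x: "x \<in> dyadic_interval (int K) l"
    then have "x < (real l + 1) / 2 ^ K"
      by (simp add: dyadic_interval_def power_int_minus divide_inverse mult.commute)
    also have "\<dots> \<le> 2 ^ K"
    proof -
      have "real l + 1 \<le> real (4 ^ K)"
        using that by (metis Suc_leI of_nat_Suc of_nat_le_iff add.commute)
      then show ?thesis by (simp add: divide_simps flip: power_mult_distrib)
    qed
    finally show False
      using False x by (simp add: mem_dyadic_interval_nat)
  qed
  then show ?thesis
    using assms False by (auto simp: dyadic_step_def indicator_def)
qed

lemma dyadic_step_eqI: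
  assumes "dyadic_step K g" "dyadic_step K h"
    and "\<And>l. l < 4 ^ K \<Longrightarrow> g (real l / 2 ^ K) = h (real l / 2 ^ K)"
  shows "g = h"
proof
  fix x
  have "g x = (\<Sum>l<4 ^ K. g (real l / 2 ^ K) * indicator (dyadic_interval (int K) l) x)"
    by (rule dyadic_step_expansion) fact
  also have "\<dots> = (\<Sum>l<4 ^ K. h (real l / 2 ^ K) * indicator (dyadic_interval (int K) l) x)"
    by (intro sum.cong) (simp_all add: assms(3))
  also have "\<dots> = h x"
    by (rule dyadic_step_expansion[symmetric]) fact
  finally show "g x = h x" .
qed

lemma test_funs_rank_leD:
  assumes "h \<in> test_funs_rank_le J"
  shows "rank_le J h" "x < 0 \<Longrightarrow> h x = 0" "\<exists>N. \<forall>x\<ge>2 ^ N. h x = 0"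
proof -
  obtain S a where fin: "finite S" and "\<forall>(j, k)\<in>S. j \<le> J"
    and h: "h = (\<lambda>x. \<Sum>(j, k)\<in>S. a j k * indicator (dyadic_interval j k) x)"
    using assms unfolding test_funs_rank_le_def by blast
  then have S: "j \<le> J" if "(j, k) \<in> S" for j k
    using that by blast
  show "rank_le J h"
    unfolding rank_le_def
  proof (intro allI impI)
    fix x y :: real
    assume xy: "0 \<le> x" "0 \<le> y" "\<forall>i\<ge>- J. binary_digit x i = binary_digit y i"
    have "(indicator (dyadic_interval j k) x :: complex) = indicator (dyadic_interval j k) y"
      if "(j, k) \<in> S" for j k
      using rank_le_mono[OF rank_le_indicator[of j k] S[OF that]] xy unfolding rank_le_def by blast
    then show "h x = h y"
      unfolding h by (intro sum.cong) auto
  qed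
  show "h x = 0" if "x < 0"
    unfolding h using that by (intro sum.neutral) (auto simp: indicator_def mem_dyadic_interval)
  obtain N where N: "\<forall>x\<in>(\<lambda>(j, k). 2 powi (- j) * (real k + 1)) ` S. x < 2 ^ N"
    using ex_power_bound fin by blast
  have "h x = 0" if "x \<ge> 2 ^ N" for x
    unfolding h
  proof (intro sum.neutral ballI, clarify)
    fix j k assume "(j, k) \<in> S"
    then have "2 powi (- j) * (real k + 1) < 2 ^ N"
      using N by force
    then show "a j k * indicator (dyadic_interval j k) x = 0"
      using that by (simp add: indicator_def dyadic_interval_def)
  qed
  then show "\<exists>N. \<forall>x\<ge>2 ^ N. h x = 0" by blast
qed

lemma test_funs_iff_dyadic_step: "h \<in> test_funs \<longleftrightarrow> (\<exists>K. dyadic_step K h)"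
proof
  assume "h \<in> test_funs"
  then obtain J where J: "h \<in> test_funs_rank_le J"
    by (auto simp: test_funs_def)
  then obtain N where N: "\<forall>x\<ge>2 ^ N. h x = 0"
    using test_funs_rank_leD(3) by blast
  have "2 ^ N \<le> (2 :: real) ^ max N (nat J)"
    by (simp add: power_increasing)
  then have "h x = 0" if "2 ^ max N (nat J) \<le> x" for x
    using N that order_trans by blast
  then have "dyadic_step (max N (nat J)) h"
    unfolding dyadic_step_def
    by (intro conjI rank_le_mono[OF test_funs_rank_leD(1)[OF J]])
      (auto dest: test_funs_rank_leD(2)[OF J])
  then show "\<exists>K. dyadic_step K h" ..
next
  assume "\<exists>K. dyadic_step K h"
  then obtain K where K: "dyadic_step K h" ..
  let ?S = "(\<lambda>l. (int K, l)) ` {..<4 ^ K}"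
  have "h = (\<lambda>x. \<Sum>(j, l)\<in>?S. h (real l / 2 ^ K) * indicator (dyadic_interval j l) x)"
  proof
    fix x
    have "h x = (\<Sum>l<4 ^ K. h (real l / 2 ^ K) * indicator (dyadic_interval (int K) l) x)"
      by (rule dyadic_step_expansion) fact
    also have "\<dots> = (\<Sum>(j, l)\<in>?S. h (real l / 2 ^ K) * indicator (dyadic_interval j l) x)"
      by (subst sum.reindex) (simp_all add: inj_on_def)
    finally show "h x = (\<Sum>(j, l)\<in>?S. h (real l / 2 ^ K) * indicator (dyadic_interval j l) x)" .
  qed
  then have "h \<in> test_funs_rank_le (int K)"
    unfolding test_funs_rank_le_def
    by (intro CollectI exI[of _ ?S] exI[of _ "\<lambda>j l. h (real l / 2 ^ K)"]) auto
  then show "h \<in> test_funs"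
    by (auto simp: test_funs_def)
qed

lemma dyadic_step_test_fun: "dyadic_step K h \<Longrightarrow> h \<in> test_funs"
  by (auto simp: test_funs_iff_dyadic_step)

lemma dyadic_step_indicator: "l < 4 ^ K \<Longrightarrow> dyadic_step K (indicator (dyadic_interval (int K) l))"
  unfolding dyadic_step_def
proof (intro conjI rank_le_indicator allI impI)
  fix x :: real assume l: "l < 4 ^ K" and x: "x < 0 \<or> 2 ^ K \<le> x"
  have "x \<notin> dyadic_interval (int K) l"
  proof
    assume *: "x \<in> dyadic_interval (int K) l"
    then have "real l = real (nat \<lfloor>x * 2 ^ K\<rfloor>)" "0 \<le> x"
      by (simp_all add: mem_dyadic_interval_nat)
    moreover from this x have "2 ^ K * 2 ^ K \<le> x * 2 ^ K" by simp
    then have "real (4 ^ K) \<le> x * 2 ^ K" by (simp flip: power_mult_distrib)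
    then have "4 ^ K \<le> nat \<lfloor>x * 2 ^ K\<rfloor>" by (metis floor_mono floor_of_nat nat_int nat_mono)
    ultimately show False
      using l by (simp only: of_nat_eq_iff)
  qed
  then show "indicator (dyadic_interval (int K) l) x = (0 :: complex)" by simp
qed

lemma rank_le_cmult: "rank_le r h \<Longrightarrow> rank_le r (\<lambda>x. a * h x)"
  unfolding rank_le_def by metis

lemma rank_le_add: "rank_le r g \<Longrightarrow> rank_le r h \<Longrightarrow> rank_le r (\<lambda>x. g x + h x)"
  unfolding rank_le_def by metis

lemma test_fun_cmult: "h \<in> test_funs \<Longrightarrow> (\<lambda>x. a * h x) \<in> test_funs"
  unfolding test_funs_iff_dyadic_step by (auto simp: dyadic_step_def intro: rank_le_cmult)

lemma test_funs_common_step: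
  assumes "g \<in> test_funs" "h \<in> test_funs"
  obtains K where "dyadic_step K g" "dyadic_step K h"
  using assms unfolding test_funs_iff_dyadic_step
  by (metis dyadic_step_mono max.cobounded1 max.cobounded2)

lemma test_fun_add: "g \<in> test_funs \<Longrightarrow> h \<in> test_funs \<Longrightarrow> (\<lambda>x. g x + h x) \<in> test_funs"
  by (erule (1) test_funs_common_step, rule dyadic_step_test_fun)
    (auto simp: dyadic_step_def intro: rank_le_add)

lemma test_fun_zero: "(\<lambda>x. 0) \<in> test_funs"
  by (rule dyadic_step_test_fun[of 0]) (simp add: dyadic_step_def rank_le_def)

lemma test_fun_sum:
  assumes "finite A" "\<And>i. i \<in> A \<Longrightarrow> g i \<in> test_funs"
  shows "(\<lambda>x. \<Sum>i\<in>A. g i x) \<in> test_funs"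
  using assms by (induction A rule: finite_induct) (auto intro: test_fun_add test_fun_zero)


section \<open>Linear functionals on test functions\<close>

definition test_linear :: "functional \<Rightarrow> bool"
  where "test_linear F \<longleftrightarrow>
    (\<forall>g\<in>test_funs. \<forall>h\<in>test_funs. F (\<lambda>x. g x + h x) = F g + F h) \<and>
    (\<forall>a. \<forall>h\<in>test_funs. F (\<lambda>x. a * h x) = a * F h)"

lemma test_linear_sum:
  assumes "test_linear F" "finite A" "\<And>i. i \<in> A \<Longrightarrow> g i \<in> test_funs"
  shows "F (\<lambda>x. \<Sum>i\<in>A. b i * g i x) = (\<Sum>i\<in>A. b i * F (g i))"
  using assms(2,3)
proof (induction A rule: finite_induct)
  case empty
  have "F (\<lambda>x. 0 * h x) = 0 * F h" if "h \<in> test_funs" for h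
    using assms(1) that unfolding test_linear_def by blast
  from this[OF test_fun_zero] show ?case by simp
next
  case (insert i A)
  have "(\<lambda>x. b i * g i x) \<in> test_funs" "(\<lambda>x. \<Sum>i\<in>A. b i * g i x) \<in> test_funs"
    using insert.prems insert.hyps(1) by (auto intro!: test_fun_cmult test_fun_sum)
  then have "F (\<lambda>x. b i * g i x + (\<Sum>i\<in>A. b i * g i x)) =
      b i * F (g i) + F (\<lambda>x. \<Sum>i\<in>A. b i * g i x)"
    using assms(1) insert.prems unfolding test_linear_def by simp
  then show ?case
    using insert by simp
qed

text \<open>
  A functional supported in \<open>A\<close> sees a test function only through its values on \<open>A\<close>, since the
  difference of two functions that agree there vanishes on \<open>A\<close>.
\<close>

lemma test_linear_eq_of_agree:
  assumes F: "test_linear F" "supported_in F A"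
    and gh: "g \<in> test_funs" "h \<in> test_funs" "\<And>x. x \<in> A \<Longrightarrow> g x = h x"
  shows "F g = F h"
proof -
  have d: "(\<lambda>x. g x + - 1 * h x) \<in> test_funs"
    by (intro test_fun_add test_fun_cmult gh)
  then have "F (\<lambda>x. g x + - 1 * h x) = 0"
    using F(2) gh(3) unfolding supported_in_def by simp
  moreover have "F (\<lambda>x. g x + - 1 * h x) = F g + - 1 * F h"
    using F(1) gh(1,2) test_fun_cmult[OF gh(2), of "- 1"] unfolding test_linear_def by metis
  ultimately show ?thesis by simp
qed

lemma distribution_linear: "F \<in> distributions \<Longrightarrow> test_linear F"
  unfolding distributions_def test_linear_def by blast

lemma test_conv_zero_common_step:
  assumes "test_conv_zero f"
  obtains K where "\<And>i. dyadic_step K (f i)"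
proof -
  obtain J b where J: "\<And>i. f i \<in> test_funs_rank_le J"
    and b: "\<And>i x. x \<notin> {0..b} \<Longrightarrow> f i x = 0"
    using assms unfolding test_conv_zero_def by blast
  obtain N where "b < 2 ^ N"
    using real_arch_pow[of 2 b] by auto
  moreover have "2 ^ N \<le> (2 :: real) ^ max N (nat J)"
    by (simp add: power_increasing)
  ultimately have "b < 2 ^ max N (nat J)" by linarith
  then have "dyadic_step (max N (nat J)) (f i)" for i
    unfolding dyadic_step_def
    by (intro conjI rank_le_mono[OF test_funs_rank_leD(1)[OF J]] allI impI b) auto
  then show ?thesis by (rule that)
qed

text \<open>
  A sequence that tends to zero in the space of test functions lives on one fixed finite grid, so
  continuity comes for free from linearity.
\<close>

lemma linear_functional_is_distribution:
  assumes "F \<in> extensional test_funs" "test_linear F"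
  shows "F \<in> distributions"
proof -
  have "(\<lambda>i. F (f i)) \<longlonglongrightarrow> 0" if f: "test_conv_zero f" for f
  proof -
    obtain K where K: "\<And>i. dyadic_step K (f i)"
      using test_conv_zero_common_step[OF f] by blast
    let ?e = "\<lambda>l. indicator (dyadic_interval (int K) l) :: real \<Rightarrow> complex"
    have "F (f i) = (\<Sum>l<4 ^ K. f i (real l / 2 ^ K) * F (?e l))" for i
    proof -
      have "f i = (\<lambda>x. \<Sum>l<4 ^ K. f i (real l / 2 ^ K) * ?e l x)"
        by (rule ext) (rule dyadic_step_expansion[OF K])
      then have "F (f i) = F (\<lambda>x. \<Sum>l<4 ^ K. f i (real l / 2 ^ K) * ?e l x)"
        by (rule arg_cong)
      also have "\<dots> = (\<Sum>l<4 ^ K. f i (real l / 2 ^ K) * F (?e l))"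
        by (rule test_linear_sum[OF assms(2)])
          (auto intro: dyadic_step_test_fun dyadic_step_indicator)
      finally show ?thesis .
    qed
    moreover have "(\<lambda>i. f i x) \<longlonglongrightarrow> 0" for x
      using f unfolding test_conv_zero_def by blast
    ultimately show ?thesis
      by (simp add: tendsto_null_sum tendsto_mult_left_zero)
  qed
  then show ?thesis
    using assms unfolding distributions_def test_linear_def by blast
qed


section \<open>The adjoint of the refinement operator\<close>

text \<open>
  The test function that the definition of \<open>F(2x \<ominus> k)\<close> hands to \<open>F\<close>.
\<close>

definition half_translate :: "nat \<Rightarrow> (real \<Rightarrow> complex) \<Rightarrow> real \<Rightarrow> complex"
  where "half_translate k h = (\<lambda>x. if 0 \<le> x then h ((x \<oplus> real k) / 2) else 0)"

text \<open>
  The transpose of the refinement operator, \<open>D h(x) = 1/2 \<Sum>\<^sub>k c\<^sub>k h((x \<oplus> k) / 2)\<close>: a distribution solves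
  the refinement equation iff \<open>F \<circ> D = F\<close>, and \<open>\<integral> (T f) h = \<integral> f (D h)\<close>.
\<close>

definition refinement_adjoint :: "nat \<Rightarrow> (nat \<Rightarrow> complex) \<Rightarrow> (real \<Rightarrow> complex) \<Rightarrow> real \<Rightarrow> complex"
  where "refinement_adjoint n c h = (\<lambda>x. \<Sum>k=0..2 ^ n. c k / 2 * half_translate k h x)"

text \<open>
  Halving moves every digit down by one position, so the composition with it needs one digit less.
\<close>

lemma rank_le_half_translate:
  assumes "rank_le r h"
  shows "rank_le (r - 1) (half_translate k h)"
  unfolding rank_le_def
proof (intro allI impI)
  fix x y :: real
  assume xy: "0 \<le> x" "0 \<le> y" "\<forall>i\<ge>- (r - 1). binary_digit x i = binary_digit y i"
  then have "binary_digit ((x \<oplus> real k) / 2) i = binary_digit ((y \<oplus> real k) / 2) i" if "- r \<le> i" for i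
    using that by (simp add: binary_digit_half binary_digit_dyadic_add_nat)
  then show "half_translate k h x = half_translate k h y"
    using xy rank_leD[OF assms] by (simp add: half_translate_def dyadic_add_nat_nonneg)
qed

lemma test_fun_half_translate:
  assumes "h \<in> test_funs"
  shows "half_translate k h \<in> test_funs"
proof -
  obtain K where K: "dyadic_step K h"
    using assms by (auto simp: test_funs_iff_dyadic_step)
  define M where "M = Suc K + k"
  have "k < 2 ^ k" by (rule less_exp)
  also have "\<dots> \<le> 2 ^ M" by (rule power_increasing) (simp_all add: M_def)
  finally have k: "real k < 2 ^ M" by (metis of_nat_less_iff of_nat_numeral of_nat_power)
  have zero: "half_translate k h x = 0" if x: "x < 0 \<or> 2 ^ M \<le> x" for x
  proof (cases "x < 0")
    case False
    then have "2 ^ M \<le> x \<oplus> real k"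
      using x k dyadic_add_nat_less_iff[of x k M] by simp
    moreover have "2 * 2 ^ K \<le> (2 :: real) ^ M"
      using power_increasing[of "Suc K" M "2 :: real"] by (simp add: M_def)
    ultimately have "2 ^ K \<le> (x \<oplus> real k) / 2" by linarith
    then show ?thesis
      using dyadic_step_outside[OF K] by (simp add: half_translate_def)
  qed (simp add: half_translate_def)
  have "rank_le (int M) (half_translate k h)"
    using K by (intro rank_le_mono[OF rank_le_half_translate[of "int K"]])
      (simp_all add: dyadic_step_def M_def)
  with zero have "dyadic_step M (half_translate k h)"
    by (auto simp: dyadic_step_def)
  then show ?thesis by (rule dyadic_step_test_fun)
qed

lemma test_fun_adjoint: "h \<in> test_funs \<Longrightarrow> refinement_adjoint n c h \<in> test_funs"
  unfolding refinement_adjoint_def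
  by (intro test_fun_sum test_fun_cmult test_fun_half_translate) simp_all

lemma test_fun_adjoint_funpow: "h \<in> test_funs \<Longrightarrow> (refinement_adjoint n c ^^ L) h \<in> test_funs"
  by (induction L) (auto intro: test_fun_adjoint)

lemma functional_adjoint:
  assumes "test_linear F" "h \<in> test_funs"
  shows "F (refinement_adjoint n c h) = (\<Sum>k=0..2 ^ n. c k * dilate_dist k F h)"
  unfolding refinement_adjoint_def
  by (subst test_linear_sum[OF assms(1)])
    (auto simp: dilate_dist_def half_translate_def[symmetric] assms(2) intro: test_fun_half_translate)

lemma rank_le_adjoint:
  assumes "rank_le r h"
  shows "rank_le (r - 1) (refinement_adjoint n c h)"
  unfolding rank_le_def refinement_adjoint_def
proof (intro allI impI)
  fix x y :: real
  assume "0 \<le> x" "0 \<le> y" "\<forall>i\<ge>- (r - 1). binary_digit x i = binary_digit y i"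
  then have "half_translate k h x = half_translate k h y" for k
    by (intro rank_leD[OF rank_le_half_translate[OF assms]]) auto
  then show "(\<Sum>k=0..2 ^ n. c k / 2 * half_translate k h x) =
      (\<Sum>k=0..2 ^ n. c k / 2 * half_translate k h y)"
    by simp
qed

lemma rank_le_adjoint_funpow:
  "rank_le r h \<Longrightarrow> rank_le (r - int L) ((refinement_adjoint n c ^^ L) h)"
proof (induction L)
  case (Suc L)
  then show ?case
    using rank_le_adjoint[of "r - int L"] by (simp add: algebra_simps)
qed simp

lemma adjoint_add:
  "refinement_adjoint n c (\<lambda>x. g x + h x) =
    (\<lambda>x. refinement_adjoint n c g x + refinement_adjoint n c h x)"
  unfolding refinement_adjoint_def half_translate_def
  by (auto simp: sum.distrib[symmetric] distrib_left intro!: ext sum.cong)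

lemma adjoint_cmult:
  "refinement_adjoint n c (\<lambda>x. a * h x) = (\<lambda>x. a * refinement_adjoint n c h x)"
  unfolding refinement_adjoint_def half_translate_def
  by (auto simp: sum_distrib_left algebra_simps intro!: ext sum.cong)

lemma adjoint_funpow_add:
  "(refinement_adjoint n c ^^ L) (\<lambda>x. g x + h x) =
    (\<lambda>x. (refinement_adjoint n c ^^ L) g x + (refinement_adjoint n c ^^ L) h x)"
  by (induction L) (simp_all add: adjoint_add)

lemma adjoint_funpow_cmult:
  "(refinement_adjoint n c ^^ L) (\<lambda>x. a * h x) = (\<lambda>x. a * (refinement_adjoint n c ^^ L) h x)"
  by (induction L) (simp_all add: adjoint_cmult)

lemma mask_index_less: "k \<le> 2 ^ n \<Longrightarrow> n \<le> M \<Longrightarrow> real k < 2 ^ Suc M"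
proof -
  assume "k \<le> 2 ^ n" "n \<le> M"
  then have "k \<le> 2 ^ M" by (meson order_trans one_le_numeral power_increasing)
  then have "real k \<le> real (2 ^ M)" by (simp only: of_nat_le_iff)
  also have "\<dots> < 2 ^ Suc M" by simp
  finally show ?thesis .
qed

lemma dyadic_shift_half_less_iff:
  assumes "0 \<le> x" "k \<le> 2 ^ n" "n \<le> M"
  shows "(x \<oplus> real k) / 2 < 2 ^ M \<longleftrightarrow> x < 2 ^ Suc M"
  using dyadic_add_nat_less_iff[OF assms(1) mask_index_less[OF assms(2,3)]] by (simp add: mult.commute)

text \<open>
  The maps \<open>x \<mapsto> (x \<oplus> k) / 2\<close> with \<open>k \<le> 2^n\<close> send \<open>[0, 2^M)\<close> into itself as soon as \<open>M \<ge> n\<close>, so \<open>D\<close> averages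
  the values of \<open>h\<close> on this interval with total weight \<open>\<Sum> c\<^sub>k / 2 = 1\<close>.
\<close>

lemma adjoint_const_on:
  assumes "(\<Sum>k=0..2 ^ n. c k) = 2" "n \<le> M"
    and h: "\<And>x. 0 \<le> x \<Longrightarrow> x < 2 ^ M \<Longrightarrow> h x = v"
    and x: "0 \<le> x" "x < 2 ^ M"
  shows "refinement_adjoint n c h x = v"
proof -
  have "half_translate k h x = v" if "k \<le> 2 ^ n" for k
  proof -
    have "(x \<oplus> real k) / 2 < 2 ^ M"
      using x dyadic_shift_half_less_iff[OF x(1) that assms(2)] by simp
    then show ?thesis
      using x h by (simp add: half_translate_def dyadic_add_nat_nonneg)
  qed
  then have "refinement_adjoint n c h x = (\<Sum>k=0..2 ^ n. c k / 2 * v)"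
    unfolding refinement_adjoint_def by (intro sum.cong) simp_all
  also have "\<dots> = (\<Sum>k=0..2 ^ n. c k) / 2 * v"
    by (simp add: sum_distrib_right sum_divide_distrib)
  finally show ?thesis
    by (simp add: assms(1))
qed

lemma adjoint_funpow_const_on:
  assumes "(\<Sum>k=0..2 ^ n. c k) = 2" "n \<le> M"
    and h: "\<And>x. 0 \<le> x \<Longrightarrow> x < 2 ^ M \<Longrightarrow> h x = v"
    and x: "0 \<le> x" "x < 2 ^ M"
  shows "(refinement_adjoint n c ^^ L) h x = v"
  using x
proof (induction L arbitrary: x)
  case (Suc L)
  show ?case
    unfolding funpow.simps o_apply by (rule adjoint_const_on[OF assms(1,2) Suc.IH Suc.prems])
qed (use h in simp)

text \<open>
  Each application of \<open>D\<close> lowers the rank by one; once the rank is at most \<open>-M\<close>, the whole of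
  \<open>[0, 2^M)\<close> is a single interval of constancy.
\<close>

lemma adjoint_funpow_flat:
  assumes "dyadic_step K h" "K + M \<le> L" "0 \<le> x" "x < 2 ^ M"
  shows "(refinement_adjoint n c ^^ L) h x = (refinement_adjoint n c ^^ L) h 0"
proof (rule rank_leD[OF rank_le_adjoint_funpow])
  show "rank_le (int K) h"
    using assms(1) by (simp add: dyadic_step_def)
  show "binary_digit x i = binary_digit 0 i" if "- (int K - int L) \<le> i" for i
    using that assms less_two_power_iff_digits[of x M] by simp
qed (use assms in simp_all)

definition block :: "nat \<Rightarrow> real \<Rightarrow> complex"
  where "block M = indicator {0..<2 ^ M}"

lemma dyadic_step_block: "dyadic_step M (block M)"
proof -
  have "rank_le (int M) (block M)"
    unfolding rank_le_def block_def indicator_def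
    by (auto simp: less_two_power_iff_digits)
  then show ?thesis
    by (auto simp: dyadic_step_def block_def indicator_def)
qed


section \<open>The refinable distribution\<close>

text \<open>
  If the \<open>c\<^sub>k\<close> sum to \<open>2\<close>, the sequence under the limit is eventually constant, and this is the value of
  \<open>D^L h\<close> on a neighbourhood of the origin for all large \<open>L\<close>.
\<close>

definition cascade_limit :: "nat \<Rightarrow> (nat \<Rightarrow> complex) \<Rightarrow> functional"
  where "cascade_limit n c = (\<lambda>h\<in>test_funs. lim (\<lambda>L. (refinement_adjoint n c ^^ L) h 0))"

context
  fixes n :: nat and c :: "nat \<Rightarrow> complex"
  assumes sum_c: "(\<Sum>k=0..2 ^ n. c k) = 2"
begin

text \<open>
  After \<open>K + M\<close> steps the iterate is flat on \<open>[0, 2^M)\<close>, and from then on its value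
  there no longer changes. All properties of the solution are read off from this.
\<close>

lemma adjoint_funpow_eq_cascade_limit:
  assumes h: "dyadic_step K h" and M: "n \<le> M" and L: "K + M \<le> L" and x: "0 \<le> x" "x < 2 ^ M"
  shows "(refinement_adjoint n c ^^ L) h x = cascade_limit n c h"
proof -
  let ?D = "refinement_adjoint n c"
  define v where "v = (?D ^^ (K + M)) h 0"
  have const: "(?D ^^ L) h x = v" if "K + M \<le> L" "0 \<le> x" "x < 2 ^ M" for L x
  proof -
    have "(?D ^^ (L - (K + M))) ((?D ^^ (K + M)) h) x = v"
      by (rule adjoint_funpow_const_on[OF sum_c M _ that(2,3)])
        (unfold v_def, rule adjoint_funpow_flat[OF h order_refl])
    then show ?thesis
      using that(1) by (metis comp_apply funpow_add le_add_diff_inverse2)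
  qed
  have "\<forall>\<^sub>F L in sequentially. (?D ^^ L) h 0 = v"
    by (rule eventually_sequentiallyI[of "K + M"]) (simp add: const)
  then have "(\<lambda>L. (?D ^^ L) h 0) \<longlonglongrightarrow> v"
    by (rule tendsto_eventually)
  then have "cascade_limit n c h = v"
    using dyadic_step_test_fun[OF h] by (simp add: cascade_limit_def limI)
  with const[OF L x] show ?thesis by simp
qed

lemma cascade_limit_linear: "test_linear (cascade_limit n c)"
  unfolding test_linear_def
proof (intro conjI ballI allI)
  fix g h assume gh: "g \<in> test_funs" "h \<in> test_funs"
  obtain K where K: "dyadic_step K g" "dyadic_step K h" "dyadic_step K (\<lambda>x. g x + h x)"
  proof -
    obtain K where "dyadic_step K g" "dyadic_step K h"
      using gh by (rule test_funs_common_step)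
    then show ?thesis
      by (intro that[of K]) (auto simp: dyadic_step_def intro: rank_le_add)
  qed
  show "cascade_limit n c (\<lambda>x. g x + h x) = cascade_limit n c g + cascade_limit n c h"
    using K[THEN adjoint_funpow_eq_cascade_limit[OF _ order_refl order_refl order_refl]]
    by (simp add: adjoint_funpow_add)
next
  fix a h assume "h \<in> test_funs"
  then obtain K where K: "dyadic_step K h" by (auto simp: test_funs_iff_dyadic_step)
  then have K': "dyadic_step K (\<lambda>x. a * h x)"
    by (auto simp: dyadic_step_def intro: rank_le_cmult)
  show "cascade_limit n c (\<lambda>x. a * h x) = a * cascade_limit n c h"
    using adjoint_funpow_eq_cascade_limit[OF K order_refl order_refl order_refl]
      adjoint_funpow_eq_cascade_limit[OF K' order_refl order_refl order_refl]
    by (simp add: adjoint_funpow_cmult)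
qed

lemma cascade_limit_adjoint:
  assumes "h \<in> test_funs"
  shows "cascade_limit n c (refinement_adjoint n c h) = cascade_limit n c h"
proof -
  obtain K where K: "dyadic_step K h" "dyadic_step K (refinement_adjoint n c h)"
    using assms test_fun_adjoint by (blast intro: test_funs_common_step)
  have "(refinement_adjoint n c ^^ (K + n)) (refinement_adjoint n c h) 0 =
      (refinement_adjoint n c ^^ Suc (K + n)) h 0"
    by (simp add: funpow_swap1)
  then show ?thesis
    using adjoint_funpow_eq_cascade_limit[OF K(2) order_refl order_refl order_refl]
      adjoint_funpow_eq_cascade_limit[OF K(1) order_refl, of "Suc (K + n)" 0]
    by simp
qed

lemma cascade_limit_solution: "refinement_solution n c (cascade_limit n c)"
  unfolding refinement_solution_def
proof
  show "cascade_limit n c \<in> distributions"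
    by (rule linear_functional_is_distribution[OF _ cascade_limit_linear])
      (simp add: cascade_limit_def)
  show "cascade_limit n c = (\<lambda>h\<in>test_funs. \<Sum>k=0..2 ^ n. c k * dilate_dist k (cascade_limit n c) h)"
  proof
    fix h
    show "cascade_limit n c h =
        (\<lambda>h\<in>test_funs. \<Sum>k=0..2 ^ n. c k * dilate_dist k (cascade_limit n c) h) h"
      using functional_adjoint[OF cascade_limit_linear, of h n c] cascade_limit_adjoint[of h]
      by (cases "h \<in> test_funs") (simp_all add: cascade_limit_def)
  qed
qed

lemma cascade_limit_const:
  assumes "h \<in> test_funs" "n \<le> M" "\<And>x. 0 \<le> x \<Longrightarrow> x < 2 ^ M \<Longrightarrow> h x = v"
  shows "cascade_limit n c h = v"
proof -
  obtain K where K: "dyadic_step K h"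
    using assms(1) by (auto simp: test_funs_iff_dyadic_step)
  show ?thesis
    using adjoint_funpow_eq_cascade_limit[OF K assms(2) order_refl, of 0]
      adjoint_funpow_const_on[OF sum_c assms(2,3), where x = 0 and L = "K + M"]
    by simp
qed

lemma cascade_limit_supported: "supported_in (cascade_limit n c) {0..2 ^ n}"
  unfolding supported_in_def by (auto intro!: cascade_limit_const[of _ n])

lemma cascade_limit_nonzero: "\<exists>h\<in>test_funs. cascade_limit n c h \<noteq> 0"
proof
  show "block n \<in> test_funs"
    by (rule dyadic_step_test_fun[OF dyadic_step_block])
  then have "cascade_limit n c (block n) = 1"
    by (rule cascade_limit_const[OF _ order_refl]) (simp add: block_def)
  then show "cascade_limit n c (block n) \<noteq> 0" by simp
qed

text \<open>
  Every solution satisfies \<open>F h = F (D^L h)\<close>. If \<open>F\<close> is supported in \<open>[0, 2^N]\<close>, then for large \<open>L\<close> it sees \<open>D^L h\<close> only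
  where this function is the constant \<open>\<phi>(h)\<close>, whence \<open>F h = \<phi>(h) F(\<chi>)\<close> for one fixed indicator \<open>\<chi>\<close>.
\<close>

lemma solution_unique:
  assumes F: "refinement_solution n c F" "compactly_supported F"
  shows "\<exists>a. F = scale_dist a (cascade_limit n c)"
proof -
  obtain N where N: "supported_in F {0..2 ^ N}"
    using F(2) by (auto simp: compactly_supported_def)
  \<comment> \<open>\<open>Suc N\<close> makes the half-open \<open>[0, 2^M)\<close> contain the right end point of \<open>[0, 2^N]\<close>.\<close>
  define M where "M = max n (Suc N)"
  have NM: "(2 :: real) ^ N < 2 ^ M"
    by (rule power_strict_increasing) (auto simp: M_def)
  have dist: "F \<in> distributions"
    and eq: "F = (\<lambda>h\<in>test_funs. \<Sum>k=0..2 ^ n. c k * dilate_dist k F h)"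
    using F(1) unfolding refinement_solution_def by blast+
  note lin = distribution_linear[OF dist]
  have inv: "F (refinement_adjoint n c h) = F h" if "h \<in> test_funs" for h
  proof -
    have "F h = (\<Sum>k=0..2 ^ n. c k * dilate_dist k F h)"
      by (subst eq) (simp only: restrict_apply' that)
    then show ?thesis
      by (simp only: functional_adjoint[OF lin that])
  qed
  have inv': "F ((refinement_adjoint n c ^^ L) h) = F h" if "h \<in> test_funs" for h L
    using that by (induction L) (simp_all add: inv test_fun_adjoint_funpow)
  have block: "block M \<in> test_funs"
    by (rule dyadic_step_test_fun[OF dyadic_step_block])
  have "F h = F (block M) * cascade_limit n c h" if h: "h \<in> test_funs" for h
  proof -
    obtain K where K: "dyadic_step K h"
      using h by (auto simp: test_funs_iff_dyadic_step)
    let ?v = "cascade_limit n c h"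
    have "F h = F ((refinement_adjoint n c ^^ (K + M)) h)"
      by (rule inv'[OF h, symmetric])
    also have "\<dots> = F (\<lambda>x. ?v * block M x)"
    proof (rule test_linear_eq_of_agree[OF lin N])
      fix x :: real assume "x \<in> {0..2 ^ N}"
      then have x: "0 \<le> x" "x < 2 ^ M"
        using NM by (simp_all only: atLeastAtMost_iff) linarith
      show "(refinement_adjoint n c ^^ (K + M)) h x = ?v * block M x"
        using x by (subst adjoint_funpow_eq_cascade_limit[OF K _ order_refl x])
          (simp_all add: M_def block_def)
    qed (auto intro: test_fun_adjoint_funpow test_fun_cmult h block)
    also have "\<dots> = ?v * F (block M)"
      using lin block unfolding test_linear_def by blast
    finally show ?thesis by simp
  qed
  moreover have "F h = undefined" if "h \<notin> test_funs" for h
    using that dist unfolding distributions_def extensional_def by blast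
  ultimately have "F = scale_dist (F (block M)) (cascade_limit n c)"
    by (auto simp: scale_dist_def fun_eq_iff)
  then show ?thesis ..
qed
end


section \<open>Integrals of step functions\<close>

lemma has_integral_dyadic_step:
  assumes "dyadic_step K h"
  shows "has_bochner_integral lebesgue h (\<Sum>l<4 ^ K. h (real l / 2 ^ K) / 2 ^ K)"
proof -
  have m: "dyadic_interval (int K) l = {real l / 2 ^ K..<real l / 2 ^ K + 1 / 2 ^ K}" for l
    by (auto simp: dyadic_interval_def power_int_minus field_simps)
  have *: "has_bochner_integral lebesgue
      (\<lambda>x. indicator (dyadic_interval (int K) l) x *\<^sub>R h (real l / 2 ^ K))
      (measure lebesgue (dyadic_interval (int K) l) *\<^sub>R h (real l / 2 ^ K))" for l
    by (rule has_bochner_integral_indicator) (simp_all add: m)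
  have "measure lebesgue (dyadic_interval (int K) l) = 1 / 2 ^ K" for l
    by (simp add: m)
  then have "has_bochner_integral lebesgue
      (\<lambda>x. \<Sum>l<4 ^ K. indicator (dyadic_interval (int K) l) x *\<^sub>R h (real l / 2 ^ K))
      (\<Sum>l<4 ^ K. h (real l / 2 ^ K) / 2 ^ K)"
    using has_bochner_integral_sum[of "{..<4 ^ K}", OF *] by (simp add: scaleR_conv_of_real)
  moreover have "(\<lambda>x. \<Sum>l<4 ^ K. indicator (dyadic_interval (int K) l) x *\<^sub>R h (real l / 2 ^ K)) = h"
  proof
    fix x
    have "(\<Sum>l<4 ^ K. indicator (dyadic_interval (int K) l) x *\<^sub>R h (real l / 2 ^ K)) =
        (\<Sum>l<4 ^ K. h (real l / 2 ^ K) * indicator (dyadic_interval (int K) l) x)"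
      by (intro sum.cong) (auto simp: indicator_def)
    also have "\<dots> = h x"
      by (rule dyadic_step_expansion[OF assms, symmetric])
    finally show "(\<Sum>l<4 ^ K. indicator (dyadic_interval (int K) l) x *\<^sub>R h (real l / 2 ^ K)) = h x" .
  qed
  ultimately show ?thesis by simp
qed

lemma integral_dyadic_step:
  assumes "dyadic_step K h"
  shows "(LINT x:{0..}|lebesgue. h x) = (\<Sum>l<4 ^ K. h (real l / 2 ^ K) / 2 ^ K)"
proof -
  have "(\<lambda>x. indicator {0..} x *\<^sub>R h x) = h"
    using dyadic_step_outside[OF assms] by (auto simp: indicator_def)
  then show ?thesis
    using has_integral_dyadic_step[OF assms]
    by (simp add: set_lebesgue_integral_def has_bochner_integral_integral_eq)
qed

lemma integrable_times_test_fun: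
  assumes f: "locally_summable f" and h: "h \<in> test_funs"
  shows "set_integrable lebesgue {0..} (\<lambda>x. f x * h x)"
proof -
  obtain K where K: "dyadic_step K h"
    using h by (auto simp: test_funs_iff_dyadic_step)
  let ?I = "dyadic_interval (int K)"
  have "set_integrable lebesgue (?I l) f" for l
  proof (rule set_integrable_subset)
    show "set_integrable lebesgue {0..2 powi (- int K) * (real l + 1)} f"
      using f by (simp add: locally_summable_def)
    show "?I l \<subseteq> {0..2 powi (- int K) * (real l + 1)}"
    proof
      fix x assume x: "x \<in> ?I l"
      then have "0 \<le> x" by (simp add: mem_dyadic_interval)
      moreover have "x \<le> 2 powi (- int K) * (real l + 1)"
        using x by (simp add: dyadic_interval_def)
      ultimately show "x \<in> {0..2 powi (- int K) * (real l + 1)}" by simp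
    qed
  qed (simp add: dyadic_interval_def)
  then have "integrable lebesgue (\<lambda>x. \<Sum>l<4 ^ K. h (real l / 2 ^ K) * (indicator (?I l) x *\<^sub>R f x))"
    unfolding set_integrable_def by (intro Bochner_Integration.integrable_sum integrable_mult_right)
  moreover have "(\<lambda>x. \<Sum>l<4 ^ K. h (real l / 2 ^ K) * (indicator (?I l) x *\<^sub>R f x)) =
      (\<lambda>x. indicator {0..} x *\<^sub>R (f x * h x))"
  proof
    fix x
    have "(\<Sum>l<4 ^ K. h (real l / 2 ^ K) * (indicator (?I l) x *\<^sub>R f x)) =
        f x * (\<Sum>l<4 ^ K. h (real l / 2 ^ K) * indicator (?I l) x)"
      unfolding sum_distrib_left by (intro sum.cong) (auto simp: indicator_def)
    also have "\<dots> = f x * h x"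
      by (simp only: dyadic_step_expansion[OF K, symmetric])
    also have "\<dots> = indicator {0..} x *\<^sub>R (f x * h x)"
      using dyadic_step_outside[OF K, of x] by (auto simp: indicator_def)
    finally show "(\<Sum>l<4 ^ K. h (real l / 2 ^ K) * (indicator (?I l) x *\<^sub>R f x)) =
        indicator {0..} x *\<^sub>R (f x * h x)" .
  qed
  ultimately show ?thesis
    by (simp add: set_integrable_def)
qed


section \<open>The Walsh--Fourier transform of step functions\<close>

lemma xor_less_two_power: "l < 2 ^ m \<Longrightarrow> b < m \<Longrightarrow> xor l (2 ^ b) < (2 ^ m :: nat)"
  by (simp add: power_strict_increasing flip: take_bit_nat_eq_self_iff)

lemma xor_two_power_twice: "xor (xor l (2 ^ b)) (2 ^ b) = (l :: nat)"
  by (simp add: xor.assoc)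

lemma sum_sign_flip:
  fixes f :: "nat \<Rightarrow> complex"
  assumes "b < m" "\<And>l. l < 2 ^ m \<Longrightarrow> f (xor l (2 ^ b)) = - f l"
  shows "(\<Sum>l<2 ^ m. f l) = 0"
proof -
  have "(\<Sum>l<2 ^ m. f l) = (\<Sum>l<2 ^ m. f (xor l (2 ^ b)))"
    by (rule sum.reindex_bij_witness[of _ "\<lambda>l. xor l (2 ^ b)" "\<lambda>l. xor l (2 ^ b)"])
      (use assms(1) in \<open>simp_all add: xor_less_two_power xor_two_power_twice\<close>)
  also have "\<dots> = - (\<Sum>l<2 ^ m. f l)"
    by (simp add: assms(2) sum_negf)
  finally show ?thesis by simp
qed

lemma rank_le_kernel:
  assumes "0 \<le> y" "y < 2 ^ K"
  shows "rank_le (int K) (\<lambda>x. walsh_kernel x y)"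
  unfolding rank_le_def using walsh_kernel_cong[OF _ _ assms] by blast

lemma rank_le_mult: "rank_le r g \<Longrightarrow> rank_le r h \<Longrightarrow> rank_le r (\<lambda>x. g x * h x)"
  unfolding rank_le_def by metis

lemma walsh_fourier_dyadic_step:
  assumes "dyadic_step K g" "0 \<le> y" "y < 2 ^ K"
  shows "walsh_fourier g y =
    (\<Sum>l<4 ^ K. walsh_kernel (real l / 2 ^ K) y * g (real l / 2 ^ K) / 2 ^ K)"
proof -
  have "dyadic_step K (\<lambda>x. walsh_kernel x y * g x)"
    using assms by (auto simp: dyadic_step_def intro: rank_le_mult rank_le_kernel)
  from integral_dyadic_step[OF this] show ?thesis
    using assms(2) by (simp add: walsh_fourier_def)
qed

text \<open>
  A frequency \<open>y \<ge> 2^K\<close> has a digit \<open>1\<close> at some position \<open>i \<ge> K\<close>. Flipping the digit of \<open>x\<close> at position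
  \<open>-1-i\<close> stays inside the intervals where \<open>g\<close> is constant but changes the sign of the kernel, so the
  integral cancels.
\<close>

lemma walsh_fourier_outside:
  assumes g: "dyadic_step K g" and y: "2 ^ K \<le> y"
  shows "walsh_fourier g y = 0"
proof -
  have y0: "0 \<le> y" using y by (meson order_trans zero_le_numeral zero_le_power)
  obtain i where i: "int K \<le> i" "binary_digit y i = 1"
    using y less_two_power_iff_digits[OF y0, of K] binary_digit_cases[of y] by (metis not_le)
  obtain A where A: "y < 2 ^ A"
    using real_arch_pow[of 2 y] by auto
  define K' where "K' = max A K"
  have K': "K \<le> K'" "y < 2 ^ K'"
  proof -
    have "(2 :: real) ^ A \<le> 2 ^ K'"
      by (rule power_increasing) (simp_all add: K'_def)
    then show "y < 2 ^ K'" using A by linarith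
  qed (simp add: K'_def)
  have "i < int K'"
    using less_two_power_iff_digits[OF y0, of K'] K'(2) i(2) by (metis not_le zero_neq_one)
  \<comment> \<open>Bit \<open>b\<close> of the grid index \<open>l\<close> is the digit of \<open>l / 2^K'\<close> at position \<open>b - K' = -1 - i\<close>.\<close>
  define b where "b = nat (int K' - 1 - i)"
  have b: "int b = int K' - 1 - i" "b < 2 * K'"
    using \<open>i < int K'\<close> i(1) by (simp_all add: b_def nat_less_iff)
  let ?f = "\<lambda>l. walsh_kernel (real l / 2 ^ K') y * g (real l / 2 ^ K') / 2 ^ K'"
  have "?f (xor l (2 ^ b)) = - ?f l" for l
  proof -
    have "walsh_kernel (real (xor l (2 ^ b)) / 2 ^ K') y = - walsh_kernel (real l / 2 ^ K') y"
      using walsh_kernel_xor[OF y0, of l b K'] i(2) b(1) y0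
      by (simp add: walsh_kernel_commute[of _ y])
    moreover have "g (real (xor l (2 ^ b)) / 2 ^ K') = g (real l / 2 ^ K')"
    proof (rule rank_leD[of "int K"])
      fix j assume j: "- int K \<le> j"
      then have "nat (j + int K') \<noteq> b"
        using b(1) i(1) K'(1) by linarith
      then show "binary_digit (real (xor l (2 ^ b)) / 2 ^ K') j = binary_digit (real l / 2 ^ K') j"
        by (simp add: binary_digit_node bit_xor_iff bit_exp_iff)
    qed (use g in \<open>simp_all add: dyadic_step_def\<close>)
    ultimately show ?thesis by simp
  qed
  then have "(\<Sum>l<2 ^ (2 * K'). ?f l) = 0"
    by (intro sum_sign_flip[OF b(2)])
  then show ?thesis
    using walsh_fourier_dyadic_step[OF dyadic_step_mono[OF g K'(1)] y0 K'(2)]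
    by (simp add: power_mult)
qed

lemma dyadic_step_walsh_fourier:
  assumes g: "dyadic_step K g"
  shows "dyadic_step K (walsh_fourier g)"
  unfolding dyadic_step_def
proof (intro conjI allI impI)
  show "rank_le (int K) (walsh_fourier g)"
    unfolding rank_le_def
  proof (intro allI impI)
    fix x y :: real
    assume xy: "0 \<le> x" "0 \<le> y" and d: "\<forall>i\<ge>- int K. binary_digit x i = binary_digit y i"
    have less: "x < 2 ^ K \<longleftrightarrow> y < 2 ^ K"
      using xy d by (simp add: less_two_power_iff_digits)
    have k: "walsh_kernel (real l / 2 ^ K) x = walsh_kernel (real l / 2 ^ K) y" if "l < 4 ^ K" for l
      using walsh_kernel_cong[OF xy _ node_less[OF that]] d xy
      by (simp add: walsh_kernel_commute[of "real l / 2 ^ K"])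
    show "walsh_fourier g x = walsh_fourier g y"
    proof (cases "x < 2 ^ K")
      case True
      then show ?thesis
        using less xy k by (simp add: walsh_fourier_dyadic_step[OF g])
    next
      case False
      then show ?thesis
        using less walsh_fourier_outside[OF g] by simp
    qed
  qed
  show "walsh_fourier g x = 0" if "x < 0 \<or> 2 ^ K \<le> x" for x
    using that walsh_fourier_outside[OF g, of x] by (auto simp: walsh_fourier_def)
qed

lemma walsh_kernel_square: "0 \<le> x \<Longrightarrow> 0 \<le> y \<Longrightarrow> walsh_kernel x y * walsh_kernel x y = 1"
  by (simp add: walsh_kernel_eq flip: power_add mult_2)

lemma bit_less_two_power: "bit l e \<Longrightarrow> l < 2 ^ m \<Longrightarrow> e < m" for l :: nat
  by (metis bit_take_bit_iff take_bit_nat_eq_self)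

text \<open>
  If \<open>j\<close> and \<open>k\<close> differ in bit \<open>e\<close>, flipping the bit of \<open>l\<close> that the pairing matches with it changes the sign
  of exactly one of the two factors.
\<close>

lemma walsh_orthogonality:
  assumes "j < 4 ^ K" "k < 4 ^ K"
  shows "(\<Sum>l<4 ^ K. walsh_kernel (real j / 2 ^ K) (real l / 2 ^ K) *
    walsh_kernel (real k / 2 ^ K) (real l / 2 ^ K)) = (if j = k then 4 ^ K else 0)"
proof (cases "j = k")
  case True
  then show ?thesis by (simp add: walsh_kernel_square)
next
  case False
  have jk: "j < 2 ^ (2 * K)" "k < 2 ^ (2 * K)"
    using assms by (simp_all add: power_mult)
  obtain e where e: "bit j e \<noteq> bit k e"
    using False bit_eq_iff by blast
  then have "e < 2 * K"
    using bit_less_two_power[OF _ jk(1)] bit_less_two_power[OF _ jk(2)] by blast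
  define b where "b = 2 * K - 1 - e"
  have b: "int K - 1 - int b = int e - int K" "b < 2 * K"
    using \<open>e < 2 * K\<close> by (auto simp: b_def of_nat_diff)
  have "(\<Sum>l<2 ^ (2 * K). walsh_kernel (real j / 2 ^ K) (real l / 2 ^ K) *
    walsh_kernel (real k / 2 ^ K) (real l / 2 ^ K)) = 0"
  proof (rule sum_sign_flip[OF b(2)])
    fix l
    have "(- 1 :: complex) ^ binary_digit (real j / 2 ^ K) (int e - int K) *
        (- 1) ^ binary_digit (real k / 2 ^ K) (int e - int K) = - 1"
      using e by (auto simp: binary_digit_node)
    then show "walsh_kernel (real j / 2 ^ K) (real (xor l (2 ^ b)) / 2 ^ K) *
        walsh_kernel (real k / 2 ^ K) (real (xor l (2 ^ b)) / 2 ^ K) =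
        - (walsh_kernel (real j / 2 ^ K) (real l / 2 ^ K) *
           walsh_kernel (real k / 2 ^ K) (real l / 2 ^ K))"
      by (simp add: walsh_kernel_xor b(1) mult.assoc mult.left_commute)
  qed
  with False show ?thesis by (simp add: power_mult)
qed

text \<open>
  On grid functions the transform is a sum over the grid, and the claim is the orthogonality of the
  finite system of Walsh characters.
\<close>

lemma walsh_fourier_inversion:
  assumes g: "dyadic_step K g"
  shows "walsh_fourier (walsh_fourier g) = g"
proof (rule dyadic_step_eqI[of K])
  note step = dyadic_step_walsh_fourier[OF g]
  show "dyadic_step K (walsh_fourier (walsh_fourier g))"
    by (rule dyadic_step_walsh_fourier) (rule step)
  fix k :: nat assume k: "k < 4 ^ K"
  let ?w = "\<lambda>j l. walsh_kernel (real j / 2 ^ K) (real l / 2 ^ K)"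
  have "walsh_fourier (walsh_fourier g) (real k / 2 ^ K) =
      (\<Sum>l<4 ^ K. ?w l k * (\<Sum>j<4 ^ K. ?w j l * g (real j / 2 ^ K) / 2 ^ K) / 2 ^ K)"
    by (simp add: walsh_fourier_dyadic_step[OF step] walsh_fourier_dyadic_step[OF g] node_less k)
  also have "\<dots> = (\<Sum>l<4 ^ K. \<Sum>j<4 ^ K. g (real j / 2 ^ K) / 4 ^ K * (?w j l * ?w k l))"
    by (simp add: sum_distrib_left sum_divide_distrib walsh_kernel_commute[of _ "real k / 2 ^ K"]
        mult_ac flip: power_mult_distrib)
  also have "\<dots> = (\<Sum>j<4 ^ K. \<Sum>l<4 ^ K. g (real j / 2 ^ K) / 4 ^ K * (?w j l * ?w k l))"
    by (rule sum.swap)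
  also have "\<dots> = (\<Sum>j<4 ^ K. g (real j / 2 ^ K) / 4 ^ K * (if j = k then 4 ^ K else 0))"
    by (intro sum.cong refl)
      (simp only: sum_distrib_left[symmetric] walsh_orthogonality k lessThan_iff)
  also have "\<dots> = g (real k / 2 ^ K)"
    using k by (simp add: if_distrib[of "(*) _"] cong: if_cong)
  finally show "walsh_fourier (walsh_fourier g) (real k / 2 ^ K) = g (real k / 2 ^ K)" .
qed (fact g)


section \<open>The Walsh--Fourier transform of the solution\<close>

definition refinement_product :: "nat \<Rightarrow> (nat \<Rightarrow> complex) \<Rightarrow> real \<Rightarrow> complex"
  where "refinement_product n c y = (\<Prod>j. refinement_mask n c (y / 2 ^ Suc j))"

text \<open>
  The character with frequency \<open>y\<close>, cut off at \<open>2^M\<close> so as to be a test function.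
\<close>

definition wave :: "real \<Rightarrow> nat \<Rightarrow> real \<Rightarrow> complex"
  where "wave y M = (\<lambda>x. if 0 \<le> x \<and> x < 2 ^ M then walsh_kernel x y else 0)"

text \<open>
  \<open>\<psi>((x \<oplus> k) / 2, y) = \<psi>(x \<oplus> k, y / 2) = \<psi>(x, y / 2) w\<^sub>k(y / 2)\<close>: characters are mapped by \<open>D\<close> to multiples of
  characters, and summation over \<open>k\<close> produces the mask. The cutoff doubles.
\<close>

lemma adjoint_wave:
  assumes "0 \<le> y" "n \<le> M"
  shows "refinement_adjoint n c (wave y M) =
    (\<lambda>x. refinement_mask n c (y / 2) * wave (y / 2) (Suc M) x)"
proof
  fix x
  have "c k / 2 * half_translate k (wave y M) x = c k / 2 * walsh k (y / 2) * wave (y / 2) (Suc M) x"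
    if "k \<le> 2 ^ n" for k
  proof (cases "0 \<le> x")
    case True
    then show ?thesis
      using assms dyadic_shift_half_less_iff[OF True that assms(2)]
      by (simp add: half_translate_def wave_def dyadic_add_nat_nonneg walsh_kernel_half
          walsh_kernel_dyadic_add)
  qed (simp add: half_translate_def wave_def)
  then have "refinement_adjoint n c (wave y M) x =
      (\<Sum>k=0..2 ^ n. c k / 2 * walsh k (y / 2) * wave (y / 2) (Suc M) x)"
    unfolding refinement_adjoint_def by (intro sum.cong) simp_all
  then show "refinement_adjoint n c (wave y M) x =
      refinement_mask n c (y / 2) * wave (y / 2) (Suc M) x"
    by (simp add: refinement_mask_def sum_distrib_right sum_distrib_left)
qed

lemma adjoint_funpow_wave:
  assumes "0 \<le> y" "n \<le> M"
  shows "(refinement_adjoint n c ^^ L) (wave y M) =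
    (\<lambda>x. (\<Prod>j<L. refinement_mask n c (y / 2 ^ Suc j)) * wave (y / 2 ^ L) (M + L) x)"
proof (induction L)
  case (Suc L)
  have "0 \<le> y / 2 ^ L" "n \<le> M + L"
    using assms by simp_all
  then show ?case
    unfolding funpow.simps o_apply Suc.IH adjoint_cmult by (simp add: adjoint_wave mult_ac)
qed simp

lemma walsh_cong:
  assumes "0 \<le> y" "0 \<le> z" "k \<le> 2 ^ n"
    and "\<And>i. - int (Suc n) \<le> i \<Longrightarrow> binary_digit y i = binary_digit z i"
  shows "walsh k y = walsh k z"
  using walsh_kernel_cong[OF assms(1,2) _ mask_index_less[OF assms(3) order_refl] assms(4)] assms(1,2)
  by (simp add: walsh_eq_kernel walsh_kernel_commute[of "real k"])

lemma mask_cong: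
  assumes "0 \<le> y" "0 \<le> z"
    and "\<And>i. - int (Suc n) \<le> i \<Longrightarrow> binary_digit y i = binary_digit z i"
  shows "refinement_mask n c y = refinement_mask n c z"
  using walsh_cong[OF assms(1,2) _ assms(3)] unfolding refinement_mask_def
  by (intro arg_cong2[where f = "(*)"] sum.cong) simp_all

lemma rank_le_refinement_product: "rank_le (int n) (refinement_product n c)"
  unfolding rank_le_def
proof (intro allI impI)
  fix x y :: real
  assume xy: "0 \<le> x" "0 \<le> y" "\<forall>i\<ge>- int n. binary_digit x i = binary_digit y i"
  have "refinement_mask n c (x / 2 ^ Suc j) = refinement_mask n c (y / 2 ^ Suc j)" for j
    by (rule mask_cong) (use xy in \<open>simp_all only: binary_digit_divide_power, auto\<close>)
  then show "refinement_product n c x = refinement_product n c y"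
    by (simp only: refinement_product_def)
qed

lemma dyadic_step_wave:
  assumes "0 \<le> y" "y < 2 ^ K"
  shows "dyadic_step K (wave y K)"
proof -
  have "rank_le (int K) (\<lambda>x. walsh_kernel x y * block K x)"
    by (intro rank_le_mult rank_le_kernel assms) (use dyadic_step_block in \<open>auto simp: dyadic_step_def\<close>)
  moreover have "wave y K x = walsh_kernel x y * block K x" if "0 \<le> x" for x
    using that by (simp add: wave_def block_def indicator_def)
  ultimately have "rank_le (int K) (wave y K)"
    unfolding rank_le_def by metis
  then show ?thesis
    by (auto simp: dyadic_step_def wave_def)
qed

context
  fixes n :: nat and c :: "nat \<Rightarrow> complex"
  assumes sum_c: "(\<Sum>k=0..2 ^ n. c k) = 2"
begin

text \<open>
  Only the digits at positions \<open>\<ge> -n-1\<close> enter the mask, as \<open>k \<le> 2^n\<close> has no binary digit above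
  position \<open>n\<close>. If they vanish, all Walsh functions in it are \<open>1\<close>; hence the infinite product has only
  finitely many factors different from \<open>1\<close>.
\<close>

lemma mask_near_zero:
  assumes "0 \<le> y" "\<And>i. - int (Suc n) \<le> i \<Longrightarrow> binary_digit y i = 0"
  shows "refinement_mask n c y = 1"
proof -
  have "refinement_mask n c y = refinement_mask n c 0"
    by (rule mask_cong) (use assms in simp_all)
  also have "\<dots> = 1"
    using sum_c by (simp add: refinement_mask_def walsh_def dyadic_pairing_def)
  finally show ?thesis .
qed

lemma mask_eventually_1:
  assumes "0 \<le> y" "y < 2 ^ A" "A + n \<le> j"
  shows "refinement_mask n c (y / 2 ^ Suc j) = 1"
proof (rule mask_near_zero)
  show "binary_digit (y / 2 ^ Suc j) i = 0" if "- int (Suc n) \<le> i" for i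
    using that assms less_two_power_iff_digits[of y A] by (simp only: binary_digit_divide_power)
qed (use assms in simp)

lemma
  assumes y: "0 \<le> y"
  shows convergent_mask_product: "convergent_prod (\<lambda>j. refinement_mask n c (y / 2 ^ Suc j))"
    and refinement_product_eq_partial:
      "y < 2 ^ A \<Longrightarrow> A + n \<le> L \<Longrightarrow>
        refinement_product n c y = (\<Prod>j<L. refinement_mask n c (y / 2 ^ Suc j))"
proof -
  obtain A where A: "y < 2 ^ A"
    using real_arch_pow[of 2 y] by auto
  show "convergent_prod (\<lambda>j. refinement_mask n c (y / 2 ^ Suc j))"
    by (rule convergent_prod_finite[of "{..<A + n}"]) (use mask_eventually_1[OF y A] in auto)
  show "refinement_product n c y = (\<Prod>j<L. refinement_mask n c (y / 2 ^ Suc j))"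
    if "y < 2 ^ A" "A + n \<le> L" for A L
    unfolding refinement_product_def
    by (rule prodinf_finite) (use mask_eventually_1[OF y that(1)] that(2) in auto)
qed

text \<open>
  Iterating \<open>D\<close> on a character collects the partial products of the mask, while the remaining
  character takes the value \<open>1\<close> at the origin.
\<close>

lemma cascade_limit_wave:
  assumes "0 \<le> y" "y < 2 ^ K" "n \<le> K"
  shows "cascade_limit n c (wave y K) = refinement_product n c y"
proof -
  have "cascade_limit n c (wave y K) = (refinement_adjoint n c ^^ (K + n)) (wave y K) 0"
    by (rule adjoint_funpow_eq_cascade_limit[OF sum_c dyadic_step_wave, symmetric, of _ _ n])
      (use assms in simp_all)
  also have "\<dots> = refinement_product n c y"
    unfolding adjoint_funpow_wave[OF assms(1,3)]
    using assms refinement_product_eq_partial[OF assms(1,2) order_refl]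
    by (simp add: wave_def walsh_kernel_0)
  finally show ?thesis .
qed

text \<open>
  The product depends on the digits at positions \<open>\<ge> -n\<close> only, so multiplication by it does not refine
  a grid with \<open>K \<ge> n\<close>.
\<close>

lemma dyadic_step_product_times:
  assumes "dyadic_step K g" "n \<le> K"
  shows "dyadic_step K (\<lambda>y. refinement_product n c y * g y)"
  using assms rank_le_mono[OF rank_le_refinement_product, of n "int K" c]
  by (auto simp: dyadic_step_def intro: rank_le_mult)

lemma locally_summable_refinement_product: "locally_summable (refinement_product n c)"
  unfolding locally_summable_def
proof
  fix b :: real
  obtain A where A: "b < 2 ^ A"
    using real_arch_pow[of 2 b] by auto
  define K where "K = max A n"
  have "(2 :: real) ^ A \<le> 2 ^ K"
    by (rule power_increasing) (simp_all add: K_def)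
  with A have b: "b < 2 ^ K" by linarith
  have "has_bochner_integral lebesgue (\<lambda>y. refinement_product n c y * block K y)
      (\<Sum>l<4 ^ K. refinement_product n c (real l / 2 ^ K) * block K (real l / 2 ^ K) / 2 ^ K)"
    by (rule has_integral_dyadic_step, rule dyadic_step_product_times[OF dyadic_step_block])
      (simp add: K_def)
  then have "integrable lebesgue (\<lambda>y. refinement_product n c y * block K y)"
    by (rule integrable.intros)
  moreover have "(\<lambda>y. refinement_product n c y * block K y) =
      (\<lambda>y. indicator {0..<2 ^ K} y *\<^sub>R refinement_product n c y)"
    by (auto simp: block_def indicator_def)
  ultimately have "set_integrable lebesgue {0..<2 ^ K} (refinement_product n c)"
    by (simp add: set_integrable_def)
  then show "set_integrable lebesgue {0..b} (refinement_product n c)"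
    by (rule set_integrable_subset) (use b in auto)
qed

text \<open>
  Fourier inversion writes \<open>g\<close> as a finite combination of cut-off characters with coefficients
  \<open>2^(-K) g^(l / 2^K)\<close>. Applying the functional term by term yields a sum over the grid, which is the
  integral because the infinite product, too, is constant on the grid intervals.
\<close>

lemma cascade_limit_eq_integral:
  assumes "g \<in> test_funs"
  shows "cascade_limit n c g = (LINT y:{0..}|lebesgue. refinement_product n c y * walsh_fourier g y)"
proof -
  obtain K0 where K0: "dyadic_step K0 g"
    using assms by (auto simp: test_funs_iff_dyadic_step)
  define K where "K = max K0 n"
  have K: "n \<le> K" and g: "dyadic_step K g"
    using dyadic_step_mono[OF K0] by (simp_all add: K_def)
  note step = dyadic_step_walsh_fourier[OF g]
  let ?y = "\<lambda>l. real l / 2 ^ K"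
  have "g = (\<lambda>x. \<Sum>l<4 ^ K. walsh_fourier g (?y l) / 2 ^ K * wave (?y l) K x)"
  proof
    fix x
    show "g x = (\<Sum>l<4 ^ K. walsh_fourier g (?y l) / 2 ^ K * wave (?y l) K x)"
    proof (cases "0 \<le> x \<and> x < 2 ^ K")
      case True
      have "g x = walsh_fourier (walsh_fourier g) x"
        by (simp only: walsh_fourier_inversion[OF g])
      also have "\<dots> = (\<Sum>l<4 ^ K. walsh_fourier g (?y l) / 2 ^ K * wave (?y l) K x)"
        using True by (simp add: walsh_fourier_dyadic_step[OF step] wave_def walsh_kernel_commute[of x]
              mult.commute)
      finally show ?thesis .
    next
      case False
      then have "g x = 0" "wave (?y l) K x = 0" for l
        using dyadic_step_outside[OF g] by (auto simp: wave_def)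
      then show ?thesis by simp
    qed
  qed
  then have "cascade_limit n c g =
      cascade_limit n c (\<lambda>x. \<Sum>l<4 ^ K. walsh_fourier g (?y l) / 2 ^ K * wave (?y l) K x)"
    by (rule arg_cong)
  also have "\<dots> = (\<Sum>l<4 ^ K. walsh_fourier g (?y l) / 2 ^ K * cascade_limit n c (wave (?y l) K))"
    by (rule test_linear_sum[OF cascade_limit_linear[OF sum_c]])
      (auto intro!: dyadic_step_test_fun dyadic_step_wave node_less)
  also have "\<dots> = (\<Sum>l<4 ^ K. refinement_product n c (?y l) * walsh_fourier g (?y l) / 2 ^ K)"
    by (intro sum.cong) (simp_all add: cascade_limit_wave node_less K)
  also have "\<dots> = (LINT y:{0..}|lebesgue. refinement_product n c y * walsh_fourier g y)"
    by (rule integral_dyadic_step[symmetric]) (rule dyadic_step_product_times[OF step K])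
  finally show ?thesis .
qed

text \<open>
  The inverse transform is a choice of preimages. Inversion shows that every test function \<open>h\<close> has one,
  namely \<open>walsh_fourier h\<close>, and whichever preimage is chosen, its transform is \<open>h\<close>.
\<close>

lemma walsh_fourier_cascade_limit:
  "walsh_fourier_dist (cascade_limit n c) = dist_of_fun (refinement_product n c)"
proof
  fix h
  show "walsh_fourier_dist (cascade_limit n c) h = dist_of_fun (refinement_product n c) h"
  proof (cases "h \<in> test_funs")
    case True
    then obtain K where K: "dyadic_step K h"
      by (auto simp: test_funs_iff_dyadic_step)
    have "walsh_fourier h \<in> test_funs" "h = walsh_fourier (walsh_fourier h)"
      using dyadic_step_test_fun[OF dyadic_step_walsh_fourier[OF K]] walsh_fourier_inversion[OF K]
      by simp_all
    then have h: "h \<in> walsh_fourier ` test_funs" by blast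
    have "inverse_walsh_fourier h \<in> test_funs" "walsh_fourier (inverse_walsh_fourier h) = h"
      unfolding inverse_walsh_fourier_def
      by (rule inv_into_into[OF h], rule f_inv_into_f[OF h])
    then show ?thesis
      using cascade_limit_eq_integral True by (simp add: walsh_fourier_dist_def dist_of_fun_def)
  qed (simp add: walsh_fourier_dist_def dist_of_fun_def)
qed

end


section \<open>The refinement operator on locally summable functions\<close>

lemma sum_unit_cells:
  "(\<Sum>j<m. indicator {real j..<real j + 1} x) = (indicator {0..<real m} x :: real)"
proof (induction m)
  case (Suc m)
  then show ?case by (auto simp: indicator_def)
qed (simp add: indicator_def)

text \<open>
  On the cell \<open>[j/2, (j+1)/2)\<close> the map \<open>x \<mapsto> 2x \<oplus> k\<close> is affine with slope \<open>2\<close> onto the unit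
  interval number \<open>j XOR k\<close>, and \<open>j \<mapsto> j XOR k\<close> permutes the unit intervals of \<open>[0, 2^M)\<close>.
\<close>

lemma has_integral_dilate:
  fixes g :: "real \<Rightarrow> complex"
  assumes g: "set_integrable lebesgue {0..<2 ^ M} g" and k: "k < 2 ^ M"
  shows "has_bochner_integral lebesgue
    (\<lambda>x. indicator {0..<2 ^ M} (2 * x) *\<^sub>R g (2 * x \<oplus> real k))
    ((LINT x:{0..<2 ^ M}|lebesgue. g x) / 2)"
proof -
  let ?cell = "\<lambda>j::nat. {real j..<real j + 1}"
  define v where "v j = (LINT x:?cell j|lebesgue. g x)" for j
  have cell: "has_bochner_integral lebesgue (\<lambda>x. indicator (?cell j) x *\<^sub>R g x) (v j)"
    if "j < 2 ^ M" for j
  proof -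
    have "real j + 1 \<le> 2 ^ M"
      using that by (metis Suc_leI add.commute of_nat_Suc of_nat_le_iff of_nat_numeral of_nat_power)
    then have "set_integrable lebesgue (?cell j) g"
      by (intro set_integrable_subset[OF g]) auto
    then show ?thesis
      unfolding v_def set_integrable_def set_lebesgue_integral_def
      by (rule has_bochner_integral_integrable)
  qed
  have M: "real (2 ^ M) = 2 ^ M" by simp
  have "has_bochner_integral lebesgue (\<lambda>x. \<Sum>j<2 ^ M. indicator (?cell j) x *\<^sub>R g x) (\<Sum>j<2 ^ M. v j)"
    by (rule has_bochner_integral_sum) (simp add: cell)
  then have total: "(\<Sum>j<2 ^ M. v j) = (LINT x:{0..<2 ^ M}|lebesgue. g x)"
    unfolding scaleR_sum_left[symmetric] sum_unit_cells M set_lebesgue_integral_def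
    by (simp add: has_bochner_integral_integral_eq)
  have perm: "xor j k < 2 ^ M" if "j < 2 ^ M" for j
    using that k by (simp flip: take_bit_nat_eq_self_iff)
  have piece: "has_bochner_integral lebesgue
      (\<lambda>x. indicator (?cell j) (2 * x) *\<^sub>R g (2 * x \<oplus> real k)) (v (xor j k) / 2)"
    if "j < 2 ^ M" for j
  proof -
    let ?t = "real (xor j k) - real j"
    have "has_bochner_integral lebesgue
        (\<lambda>x. indicator (?cell (xor j k)) (?t + 2 * x) *\<^sub>R g (?t + 2 * x)) (v (xor j k) /\<^sub>R \<bar>2\<bar>)"
      using has_bochner_integral_lebesgue_real_affine_iff[THEN iffD1, OF _ cell[OF perm[OF that]], of 2 ?t]
      by simp
    moreover have "indicator (?cell (xor j k)) (?t + 2 * x) *\<^sub>R g (?t + 2 * x) =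
        indicator (?cell j) (2 * x) *\<^sub>R g (2 * x \<oplus> real k)" for x
    proof (cases "2 * x \<in> ?cell j")
      case True
      then have "2 * x \<oplus> real k = real (xor j k) + (2 * x - real j)"
        using dyadic_add_nat[of "2 * x - real j" j k] by simp
      then have "?t + 2 * x = 2 * x \<oplus> real k" by simp
      moreover have "?t + 2 * x \<in> ?cell (xor j k)" using True by simp
      ultimately show ?thesis using True by simp
    next
      case False
      then show ?thesis by (auto simp: indicator_def)
    qed
    ultimately have "has_bochner_integral lebesgue
        (\<lambda>x. indicator (?cell j) (2 * x) *\<^sub>R g (2 * x \<oplus> real k)) (v (xor j k) /\<^sub>R \<bar>2\<bar>)"
      by (simp only:)
    moreover have "v (xor j k) /\<^sub>R \<bar>2\<bar> = v (xor j k) / 2"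
      by (simp add: scaleR_conv_of_real)
    ultimately show ?thesis by (simp only:)
  qed
  have "has_bochner_integral lebesgue
      (\<lambda>x. \<Sum>j<2 ^ M. indicator (?cell j) (2 * x) *\<^sub>R g (2 * x \<oplus> real k)) (\<Sum>j<2 ^ M. v (xor j k) / 2)"
    by (rule has_bochner_integral_sum) (simp add: piece)
  moreover have "(\<Sum>j<2 ^ M. v (xor j k) / 2) = (\<Sum>j<2 ^ M. v j / 2)"
    by (rule sum.reindex_bij_witness[of _ "\<lambda>j. xor j k" "\<lambda>j. xor j k"])
      (simp_all add: perm xor.assoc)
  ultimately show ?thesis
    unfolding scaleR_sum_left[symmetric] sum_unit_cells M
    by (simp only: total flip: sum_divide_distrib)
qed

lemma locally_summable_dilate:
  assumes "locally_summable f"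
  shows "locally_summable (\<lambda>x. f (2 * x \<oplus> real k))"
  unfolding locally_summable_def
proof
  fix b :: real
  obtain A where A: "2 * b < 2 ^ A"
    using real_arch_pow[of 2 "2 * b"] by auto
  define M where "M = max A k"
  have "(2 :: real) ^ A \<le> 2 ^ M"
    by (rule power_increasing) (simp_all add: M_def)
  with A have b: "2 * b < 2 ^ M" by linarith
  have "k < 2 ^ k" by (rule less_exp)
  also have "\<dots> \<le> 2 ^ M" by (rule power_increasing) (simp_all add: M_def)
  finally have k: "k < 2 ^ M" .
  have "set_integrable lebesgue {0..2 ^ M} f"
    using assms unfolding locally_summable_def by blast
  then have "set_integrable lebesgue {0..<2 ^ M} f"
    by (rule set_integrable_subset) auto
  then have "integrable lebesgue (\<lambda>x. indicator {0..<2 ^ M} (2 * x) *\<^sub>R f (2 * x \<oplus> real k))"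
    by (rule integrable.intros[OF has_integral_dilate[OF _ k]])
  then have "set_integrable lebesgue {0..<2 ^ M / 2} (\<lambda>x. f (2 * x \<oplus> real k))"
    unfolding set_integrable_def
    by (rule back_subst[of "integrable lebesgue"]) (auto simp: indicator_def mult.commute)
  then show "set_integrable lebesgue {0..b} (\<lambda>x. f (2 * x \<oplus> real k))"
    by (rule set_integrable_subset) (use b in auto)
qed

lemma set_integral_sum:
  fixes f :: "'i \<Rightarrow> 'a \<Rightarrow> complex"
  assumes "finite I" "\<And>i. i \<in> I \<Longrightarrow> set_integrable M A (f i)"
  shows "set_integrable M A (\<lambda>x. \<Sum>i\<in>I. f i x)"
    and "(LINT x:A|M. \<Sum>i\<in>I. f i x) = (\<Sum>i\<in>I. LINT x:A|M. f i x)"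
  using assms unfolding set_integrable_def set_lebesgue_integral_def scaleR_sum_right
  by - (rule Bochner_Integration.integrable_sum Bochner_Integration.integral_sum, blast)+

lemma locally_summable_refinement_operator:
  assumes "locally_summable f"
  shows "locally_summable (refinement_operator n c f)"
  using locally_summable_dilate[OF assms]
  unfolding locally_summable_def refinement_operator_def
  by (intro allI set_integral_sum(1) set_integrable_mult_right) simp_all

text \<open>
  Substitution \<open>u = 2x \<oplus> k\<close>, whose inverse is \<open>x = (u \<oplus> k) / 2\<close>. The test function confines both
  integrals to a bounded interval, where local summability of \<open>f\<close> gives integrability.
\<close>

lemma integral_dilate_times_test_fun:
  assumes f: "locally_summable f" and h: "h \<in> test_funs"
  shows "(LINT x:{0..}|lebesgue. f (2 * x \<oplus> real k) * h x) =
    (LINT u:{0..}|lebesgue. f u * half_translate k h u) / 2"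
proof -
  obtain K where K: "dyadic_step K h" "dyadic_step K (half_translate k h)"
    using h test_fun_half_translate by (blast intro: test_funs_common_step)
  define M where "M = Suc K + k"
  have "k < 2 ^ k" by (rule less_exp)
  also have "\<dots> \<le> 2 ^ M" by (rule power_increasing) (simp_all add: M_def)
  finally have k: "k < 2 ^ M" .
  have KM: "(2 :: real) * 2 ^ K \<le> 2 ^ M"
    using power_increasing[of "Suc K" M "2 :: real"] by (simp add: M_def)
  have out: "h x = 0" "half_translate k h (2 * x) = 0" if "x < 0 \<or> 2 ^ M \<le> 2 * x" for x
    using that KM by (auto intro!: dyadic_step_outside[OF K(1)] dyadic_step_outside[OF K(2)])
  let ?g = "\<lambda>u. f u * half_translate k h u"
  have left: "indicator {0..} x *\<^sub>R (f (2 * x \<oplus> real k) * h x) =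
      indicator {0..<2 ^ M} (2 * x) *\<^sub>R ?g (2 * x \<oplus> real k)" for x
  proof (cases "0 \<le> x")
    case True
    then have "half_translate k h (2 * x \<oplus> real k) = h x"
      by (simp add: half_translate_def dyadic_add_nat_nonneg dyadic_add_nat_involution)
    with True show ?thesis
      using out(1)[of x] by (auto simp: indicator_def)
  qed (simp add: indicator_def)
  have right: "indicator {0..} u *\<^sub>R ?g u = indicator {0..<2 ^ M} u *\<^sub>R ?g u" for u
    using out(2)[of "u / 2"] by (auto simp: indicator_def)
  have "set_integrable lebesgue {0..<2 ^ M} ?g"
    by (rule set_integrable_subset[OF integrable_times_test_fun[OF f test_fun_half_translate[OF h]]]) auto
  from has_integral_dilate[OF this k] show ?thesis
    unfolding set_lebesgue_integral_def left right
    by (rule has_bochner_integral_integral_eq)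
qed

lemma dist_of_refinement_operator:
  assumes f: "locally_summable f" and h: "h \<in> test_funs"
  shows "dist_of_fun (refinement_operator n c f) h = dist_of_fun f (refinement_adjoint n c h)"
proof -
  have l: "set_integrable lebesgue {0..} (\<lambda>x. c k * (f (2 * x \<oplus> real k) * h x))" for k
    by (intro set_integrable_mult_right integrable_times_test_fun locally_summable_dilate f h)
  have r: "set_integrable lebesgue {0..} (\<lambda>x. c k / 2 * (f x * half_translate k h x))" for k
    by (intro set_integrable_mult_right integrable_times_test_fun test_fun_half_translate f h)
  have "(LINT x:{0..}|lebesgue. refinement_operator n c f x * h x) =
      (LINT x:{0..}|lebesgue. \<Sum>k=0..2 ^ n. c k * (f (2 * x \<oplus> real k) * h x))"
    by (simp add: refinement_operator_def sum_distrib_right mult.assoc)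
  also have "\<dots> = (\<Sum>k=0..2 ^ n. c k * (LINT x:{0..}|lebesgue. f (2 * x \<oplus> real k) * h x))"
    using l by (subst set_integral_sum(2)) simp_all
  also have "\<dots> = (\<Sum>k=0..2 ^ n. c k / 2 * (LINT x:{0..}|lebesgue. f x * half_translate k h x))"
    by (simp add: integral_dilate_times_test_fun[OF f h])
  also have "\<dots> = (LINT x:{0..}|lebesgue. \<Sum>k=0..2 ^ n. c k / 2 * (f x * half_translate k h x))"
    using r by (subst set_integral_sum(2)) simp_all
  also have "\<dots> = (LINT x:{0..}|lebesgue. f x * refinement_adjoint n c h x)"
    by (simp add: refinement_adjoint_def sum_distrib_left mult_ac)
  finally show ?thesis
    using h test_fun_adjoint[OF h] by (simp add: dist_of_fun_def)
qed

lemma locally_summable_funpow: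
  "locally_summable f \<Longrightarrow> locally_summable ((refinement_operator n c ^^ k) f)"
  by (induction k) (simp_all add: locally_summable_refinement_operator)

lemma dist_of_refinement_operator_funpow:
  assumes "locally_summable f" "h \<in> test_funs"
  shows "dist_of_fun ((refinement_operator n c ^^ k) f) h =
    dist_of_fun f ((refinement_adjoint n c ^^ k) h)"
  using assms(2)
proof (induction k arbitrary: h)
  case (Suc k)
  have "dist_of_fun ((refinement_operator n c ^^ Suc k) f) h =
      dist_of_fun ((refinement_operator n c ^^ k) f) (refinement_adjoint n c h)"
    using dist_of_refinement_operator[OF locally_summable_funpow[OF assms(1)] Suc.prems] by simp
  also have "\<dots> = dist_of_fun f ((refinement_adjoint n c ^^ Suc k) h)"
    using Suc.IH[OF test_fun_adjoint[OF Suc.prems]] by (simp add: funpow_swap1)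
  finally show ?case .
qed simp

text \<open>
  Since \<open>\<integral> (T^L f) h = \<integral> f (D^L h)\<close> and \<open>D^L h\<close> is eventually the constant \<open>\<phi>(h)\<close> on an interval that carries
  \<open>f\<close>, the sequence is even eventually constant on each test function.
\<close>

lemma cascade_converges:
  assumes sum_c: "(\<Sum>k=0..2 ^ n. c k) = 2" and f: "compactly_supported_L1_L2 f"
  shows "locally_summable ((refinement_operator n c ^^ k) f)"
    and "dist_converges (\<lambda>k. dist_of_fun ((refinement_operator n c ^^ k) f))
      (scale_dist (LINT x:{0..}|lebesgue. f x) (cascade_limit n c))"
proof -
  have int: "set_integrable lebesgue {0..} f"
    using f by (simp add: compactly_supported_L1_L2_def)
  obtain b where b: "AE x in lebesgue. b < x \<longrightarrow> f x = 0"
    using f by (auto simp: compactly_supported_L1_L2_def)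
  have loc: "locally_summable f"
    unfolding locally_summable_def by (auto intro: set_integrable_subset[OF int])
  then show "locally_summable ((refinement_operator n c ^^ k) f)"
    by (rule locally_summable_funpow)
  obtain A where A: "b < 2 ^ A"
    using real_arch_pow[of 2 b] by auto
  define M where "M = max A n"
  have "(2 :: real) ^ A \<le> 2 ^ M"
    by (rule power_increasing) (simp_all add: M_def)
  with A have bM: "b < 2 ^ M" by linarith
  let ?I = "LINT x:{0..}|lebesgue. f x"
  show "dist_converges (\<lambda>k. dist_of_fun ((refinement_operator n c ^^ k) f))
      (scale_dist ?I (cascade_limit n c))"
    unfolding dist_converges_def
  proof
    fix h assume h: "h \<in> test_funs"
    then obtain K where K: "dyadic_step K h"
      by (auto simp: test_funs_iff_dyadic_step)
    let ?v = "cascade_limit n c h"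
    have "dist_of_fun ((refinement_operator n c ^^ L) f) h = scale_dist ?I (cascade_limit n c) h"
      if L: "K + M \<le> L" for L
    proof -
      let ?Dh = "(refinement_adjoint n c ^^ L) h"
      have Dh: "?Dh \<in> test_funs" by (rule test_fun_adjoint_funpow[OF h])
      have "(LINT x:{0..}|lebesgue. f x * ?Dh x) = (LINT x:{0..}|lebesgue. ?v * f x)"
        unfolding set_lebesgue_integral_def
      proof (rule integral_cong_AE)
        show "(\<lambda>x. indicator {0..} x *\<^sub>R (f x * ?Dh x)) \<in> borel_measurable lebesgue"
          using integrable_times_test_fun[OF loc Dh] unfolding set_integrable_def
          by (rule borel_measurable_integrable)
        show "(\<lambda>x. indicator {0..} x *\<^sub>R (?v * f x)) \<in> borel_measurable lebesgue"
          using set_integrable_mult_right[of ?v, OF int] unfolding set_integrable_def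
          by (rule borel_measurable_integrable)
        show "AE x in lebesgue. indicator {0..} x *\<^sub>R (f x * ?Dh x) = indicator {0..} x *\<^sub>R (?v * f x)"
          using b
        proof (rule AE_mp, intro AE_I2 impI)
          fix x :: real assume x: "b < x \<longrightarrow> f x = 0"
          show "indicator {0..} x *\<^sub>R (f x * ?Dh x) = indicator {0..} x *\<^sub>R (?v * f x)"
          proof (cases "0 \<le> x \<and> x \<le> b")
            case True
            then have "?Dh x = ?v"
              using bM by (intro adjoint_funpow_eq_cascade_limit[OF sum_c K _ L]) (simp_all add: M_def)
            then show ?thesis by (simp add: mult.commute)
          next
            case False
            then show ?thesis using x by (auto simp: indicator_def)
          qed
        qed
      qed
      then show ?thesis
        using dist_of_refinement_operator_funpow[OF loc h] h Dh
        by (simp add: dist_of_fun_def scale_dist_def)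
    qed
    then show "(\<lambda>L. dist_of_fun ((refinement_operator n c ^^ L) f) h)
        \<longlonglongrightarrow> scale_dist ?I (cascade_limit n c) h"
      by (intro tendsto_eventually eventually_sequentiallyI)
  qed
qed


section \<open>The refinement equation\<close>

theorem theorem2:
  fixes n :: nat and c :: "nat \<Rightarrow> complex"
  assumes "(\<Sum>k=0..2 ^ n. c k) = 2"
  shows "\<exists>\<phi>. refinement_solution n c \<phi> \<and>
    (\<exists>h\<in>test_funs. \<phi> h \<noteq> 0) \<and>
    (\<forall>F. refinement_solution n c F \<and> compactly_supported F \<longrightarrow> (\<exists>a. F = scale_dist a \<phi>)) \<and>
    supported_in \<phi> {0..2 ^ n} \<and>
    (\<forall>y\<ge>0. convergent_prod (\<lambda>j. refinement_mask n c (y / 2 ^ Suc j))) \<and>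
    locally_summable (\<lambda>y. \<Prod>j. refinement_mask n c (y / 2 ^ Suc j)) \<and>
    walsh_fourier_dist \<phi> = dist_of_fun (\<lambda>y. \<Prod>j. refinement_mask n c (y / 2 ^ Suc j)) \<and>
    (\<forall>f. compactly_supported_L1_L2 f \<longrightarrow>
      (\<forall>k. locally_summable ((refinement_operator n c ^^ k) f)) \<and>
      dist_converges (\<lambda>k. dist_of_fun ((refinement_operator n c ^^ k) f))
        (scale_dist (LINT x:{0..}|lebesgue. f x) \<phi>))"
proof (intro exI[of _ "cascade_limit n c"] conjI allI impI)
  have product: "(\<lambda>y. \<Prod>j. refinement_mask n c (y / 2 ^ Suc j)) = refinement_product n c"
    by (rule ext) (simp only: refinement_product_def)
  show "refinement_solution n c (cascade_limit n c)"
    by (rule cascade_limit_solution) fact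
  show "\<exists>h\<in>test_funs. cascade_limit n c h \<noteq> 0"
    by (rule cascade_limit_nonzero) fact
  show "\<exists>a. F = scale_dist a (cascade_limit n c)"
    if "refinement_solution n c F \<and> compactly_supported F" for F
    using that solution_unique[OF assms] by blast
  show "supported_in (cascade_limit n c) {0..2 ^ n}"
    by (rule cascade_limit_supported) fact
  show "convergent_prod (\<lambda>j. refinement_mask n c (y / 2 ^ Suc j))" if "0 \<le> y" for y
    by (rule convergent_mask_product[OF assms that])
  show "locally_summable (\<lambda>y. \<Prod>j. refinement_mask n c (y / 2 ^ Suc j))"
    unfolding product by (rule locally_summable_refinement_product) fact
  show "walsh_fourier_dist (cascade_limit n c) =
      dist_of_fun (\<lambda>y. \<Prod>j. refinement_mask n c (y / 2 ^ Suc j))"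
    unfolding product by (rule walsh_fourier_cascade_limit) fact
  fix f assume f: "compactly_supported_L1_L2 f"
  show "locally_summable ((refinement_operator n c ^^ k) f)" for k
    by (rule cascade_converges(1)[OF assms f])
  show "dist_converges (\<lambda>k. dist_of_fun ((refinement_operator n c ^^ k) f))
      (scale_dist (LINT x:{0..}|lebesgue. f x) (cascade_limit n c))"
    by (rule cascade_converges(2)[OF assms f])
qed

end
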